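(* Define sequences $(a_k)_{k\ge1}$ and $(c_k)_{k\ge 1}$ by $a_1=4$, $c_1=6$ and, for $k\ge 2$, $$a_k=a_{k-1}+2c_{k-1},\qquad c_k=a_{k-1}+4c_{k-1}.$$ Let $T$ be a rooted tree that is a unit rectangle visibility graph. Then for every $k\ge 1$ the number of vertices of $T$ at depth $k$ is at most $c_k$. Furthermore, this bound is tight: for every $k\ge 1$ there is a rooted tree that is a unit rectangle visibility graph and has exactly $c_k$ vertices at depth $k$.
   Context: The depth of a vertex in a rooted tree is its distance from the root. A finite simple graph $G$ is a unit rectangle visibility graph (URVG) if its vertices $v$ can be represented by closed unit squares $S_v$ in the plane with sides parallel to the coordinate axes and with pairwise disjoint interiors (squares may touch along their boundaries), in such a way that two distinct vertices $v,w$ are adjacent if and only if there is an unobstructed non-degenerate (positive width) horizontal or vertical band of visibility joining $S_v$ and $S_w$. Here a horizontal band of visibility joining $S_v$ and $S_w$ is given by an open interval $I$ of positive length such that for every $y_0\in I$ the line $y=y_0$ meets the interiors of both $S_v$ and $S_w$, and the part of this line between $S_v$ and $S_w$ (possibly a single point if the squares touch) meets the interior of no other square of the representation; vertical bands are defined analogously with the roles of $x$ and $y$ exchanged. *)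

theory Defs
  imports "HOL-Analysis.Analysis" "Graph_Theory.Graph_Theory"
begin

text \<open>
  A finite simple graph is a \<^locale>\<open>pair_graph\<close>, that is, a finite loop-free symmetric digraph.
  Every edge is thus a pair of opposite arcs and counts as a library cycle of length 2, so the
  library predicate \<^const>\<open>forest\<close> (and with it \<^const>\<open>Digraph_Component.tree\<close>) does not
  describe undirected trees. The cycles of the undirected graph are those of length at least 3.
\<close>

definition undirected_tree :: "'a pair_pre_digraph \<Rightarrow> bool" where
  "undirected_tree T \<longleftrightarrow> pair_graph T \<and> Digraph_Component.connected (with_proj T) \<and>
     \<not> (\<exists>p. pre_digraph.cycle (with_proj T) p \<and> 3 \<le> length p)"

definition rooted_tree :: "'a pair_pre_digraph \<Rightarrow> 'a \<Rightarrow> bool" where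
  "rooted_tree T r \<longleftrightarrow> undirected_tree T \<and> r \<in> pverts T"

definition depth :: "'a pair_pre_digraph \<Rightarrow> 'a \<Rightarrow> 'a \<Rightarrow> ereal" where
  "depth T r v = wf_digraph.\<mu> (with_proj T) (\<lambda>_. 1) r v"

definition verts_at_depth :: "'a pair_pre_digraph \<Rightarrow> 'a \<Rightarrow> nat \<Rightarrow> 'a set" where
  "verts_at_depth T r k = {v \<in> pverts T. depth T r v = ereal (real k)}"

definition unit_square :: "(real \<times> real) set \<Rightarrow> bool" where
  "unit_square Q \<longleftrightarrow> (\<exists>x y. Q = {x..x + 1} \<times> {y..y + 1})"

definition slice :: "(real \<times> real) set \<Rightarrow> real \<Rightarrow> real set" where
  "slice Q y = {x. (x, y) \<in> Q}"

text \<open>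
  For compact intervals with disjoint interiors, this is the closed gap between them,
  a single point if they touch.
\<close>

definition gap :: "real set \<Rightarrow> real set \<Rightarrow> real set" where
  "gap A B = {x. (\<forall>a\<in>A. \<forall>b\<in>B. a \<le> x \<and> x \<le> b) \<or> (\<forall>a\<in>A. \<forall>b\<in>B. b \<le> x \<and> x \<le> a)}"

definition horizontal_band ::
  "'a set \<Rightarrow> ('a \<Rightarrow> (real \<times> real) set) \<Rightarrow> 'a \<Rightarrow> 'a \<Rightarrow> bool" where
  "horizontal_band V S v w \<longleftrightarrow>
     (\<exists>c d. c < d \<and> (\<forall>y\<in>{c<..<d}.
        (\<exists>x. (x, y) \<in> interior (S v)) \<and> (\<exists>x. (x, y) \<in> interior (S w)) \<and>
        (\<forall>u\<in>V - {v, w}. \<forall>x\<in>gap (slice (S v) y) (slice (S w) y). (x, y) \<notin> interior (S u))))"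

definition vertical_band ::
  "'a set \<Rightarrow> ('a \<Rightarrow> (real \<times> real) set) \<Rightarrow> 'a \<Rightarrow> 'a \<Rightarrow> bool" where
  "vertical_band V S v w \<longleftrightarrow> horizontal_band V (\<lambda>u. prod.swap ` S u) v w"

definition urv_representation ::
  "'a pair_pre_digraph \<Rightarrow> ('a \<Rightarrow> (real \<times> real) set) \<Rightarrow> bool" where
  "urv_representation G S \<longleftrightarrow>
     (\<forall>v\<in>pverts G. unit_square (S v)) \<and>
     (\<forall>v\<in>pverts G. \<forall>w\<in>pverts G. v \<noteq> w \<longrightarrow>
        interior (S v) \<inter> interior (S w) = {} \<and>
        ((v, w) \<in> parcs G \<longleftrightarrow>
           horizontal_band (pverts G) S v w \<or> vertical_band (pverts G) S v w))"

definition URVG :: "'a pair_pre_digraph \<Rightarrow> bool" where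
  "URVG G \<longleftrightarrow> pair_graph G \<and> (\<exists>S. urv_representation G S)"

end

theory Submission
  imports Defs
begin

text \<open>
  Upper bound. Colour each edge by a direction of visibility. The squares met by a horizontal line in
  general position form a path of horizontal edges, and in a tree no two neighbours of a vertex are
  joined by a path avoiding it. Hence every vertex has at most three horizontal neighbours, and if it
  has three, then two lie on one side of it while everything on its other side is exactly aligned with
  it, a bare path. So the horizontal components are subdivided caterpillars of maximum degree 3, and
  from any vertex of such a component at most \<open>2 i + 1\<close> vertices of it are at distance \<open>i\<close>. Splitting
  a path at its first change of colour gives \<open>D k \<le> (\<Sum>i=1..k. (2 i + 1) D (k - i))\<close> for the
  number of paths of length \<open>k\<close> with a given first colour, and \<open>c k = 2 D k\<close>.

  Tightness. Take every component to be the extremal caterpillar: row \<open>j\<close> of a horizontal component has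
  height \<open>j / 2\<close> and consists of the spine vertex number \<open>j\<close> and its leg. Even rows extend to the left
  and odd rows to the right, so that only the innermost squares of neighbouring rows see each other.
  Different components are kept apart by a large factor.
\<close>

section \<open>Visibility between unit squares in coordinates\<close>

text \<open>The coefficient \<open>2 i + 1\<close> comes from the dead branch. A vertex with three
  horizontal neighbours has one branch that is a bare path, with at most one vertex at each
  distance. Each of the other two is at best a spine all of whose vertices carry a bare leg: at
  distance \<open>i\<close> it has one spine vertex and one vertex on each of the
  \<open>i - 1\<close> legs that start earlier, hence \<open>i\<close> in all.

  Squares may touch or have aligned sides, while edges need bands of positive width. Sight lines are
  therefore taken at heights that avoid all sides, where a line can be moved a little without
  changing the squares it meets.

  The difficulty of the construction is that each vertex lies in a horizontal and in a vertical
  component at once, so both layouts must fit together. Numbers of vertices grow from parent to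
  child and can serve as signed distances from the origin: a component spreads along one axis by the
  numbers of its members and gets its place on the other axis from the number of its root.\<close>

definition usquare :: "('a \<Rightarrow> real) \<Rightarrow> ('a \<Rightarrow> real) \<Rightarrow> 'a \<Rightarrow> (real \<times> real) set" where
  "usquare x y v = {x v..x v + 1} \<times> {y v..y v + 1}"

definition meets :: "('a \<Rightarrow> real) \<Rightarrow> 'a \<Rightarrow> real \<Rightarrow> bool" where
  "meets y v t \<longleftrightarrow> y v < t \<and> t < y v + 1"

definition separated :: "('a \<Rightarrow> real) \<Rightarrow> ('a \<Rightarrow> real) \<Rightarrow> 'a \<Rightarrow> 'a \<Rightarrow> bool" where
  "separated x y v w \<longleftrightarrow> 1 \<le> \<bar>x v - x w\<bar> \<or> 1 \<le> \<bar>y v - y w\<bar>"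

definition strictly_between :: "('a \<Rightarrow> real) \<Rightarrow> 'a \<Rightarrow> 'a \<Rightarrow> 'a \<Rightarrow> bool" where
  "strictly_between x v w u \<longleftrightarrow> x v < x u \<and> x u < x w \<or> x w < x u \<and> x u < x v"

text \<open>Left ends suffice: the squares met by one line have disjoint interiors, so they are
  ordered by \<open>x\<close>, and a square obstructs the gap exactly when its left end is strictly
  between the two others. Exchanging \<open>x\<close> and \<open>y\<close> gives vertical
  visibility.\<close>

definition sees ::
  "'a set \<Rightarrow> ('a \<Rightarrow> real) \<Rightarrow> ('a \<Rightarrow> real) \<Rightarrow> 'a \<Rightarrow> 'a \<Rightarrow> bool" where
  "sees V x y v w \<longleftrightarrow> (\<exists>c d. c < d \<and> (\<forall>t\<in>{c<..<d}. meets y v t \<and> meets y w t \<and>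
     (\<forall>u\<in>V. meets y u t \<longrightarrow> \<not> strictly_between x v w u)))"

lemma interior_usquare: "interior (usquare x y v) = {x v<..<x v + 1} \<times> {y v<..<y v + 1}"
  by (simp add: usquare_def interior_Times)

lemma in_interior_usquare: "(a, t) \<in> interior (usquare x y v) \<longleftrightarrow> x v < a \<and> a < x v + 1 \<and> meets y v t"
  by (auto simp: interior_usquare meets_def)

lemma interior_usquare_disjoint_iff:
  "interior (usquare x y v) \<inter> interior (usquare x y w) = {} \<longleftrightarrow> separated x y v w"
proof -
  have overlap: "{a<..<a + 1} \<inter> {b<..<b + 1} = {} \<longleftrightarrow> 1 \<le> \<bar>a - b\<bar>" for a b :: real
  proof
    assume e: "{a<..<a + 1} \<inter> {b<..<b + 1} = {}"
    show "1 \<le> \<bar>a - b\<bar>"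
    proof (rule ccontr)
      assume "\<not> 1 \<le> \<bar>a - b\<bar>"
      then have "(a + b + 1) / 2 \<in> {a<..<a + 1} \<inter> {b<..<b + 1}"
        by (auto simp: abs_if field_simps split: if_splits)
      with e show False by blast
    qed
  qed (auto simp: abs_if split: if_splits)
  show ?thesis
    by (simp only: interior_usquare Times_Int_Times Times_empty overlap separated_def)
qed

lemma separated_commute: "separated x y v w \<longleftrightarrow> separated y x v w"
  by (auto simp: separated_def)

lemma separated_meets:
  assumes "separated x y v w" "meets y v t" "meets y w t"
  shows "1 \<le> \<bar>x v - x w\<bar>"
  using assms by (auto simp: separated_def meets_def)

lemma gap_unit_intervals:
  "gap {a..a + 1} {b..b + 1} = {z. a + 1 \<le> z \<and> z \<le> b \<or> b + 1 \<le> z \<and> z \<le> (a::real)}"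
  unfolding gap_def
  by (auto dest: bspec[of _ _ a] bspec[of _ _ "a + 1"] bspec[of _ _ b] bspec[of _ _ "b + 1"])
     (smt (verit) atLeastAtMost_iff)+

lemma horizontal_band_iff_sees:
  assumes S: "\<And>u. u \<in> V \<Longrightarrow> S u = usquare x y u"
    and sep: "\<And>u w. u \<in> V \<Longrightarrow> w \<in> V \<Longrightarrow> u \<noteq> w \<Longrightarrow> separated x y u w"
    and vw: "v \<in> V" "w \<in> V" "v \<noteq> w"
  shows "horizontal_band V S v w \<longleftrightarrow> sees V x y v w"
proof -
  have blocked: "(\<exists>a\<in>gap (slice (S v) t) (slice (S w) t). (a, t) \<in> interior (S u)) \<longleftrightarrow>
      meets y u t \<and> strictly_between x v w u"
    if mv: "meets y v t" and mw: "meets y w t" and u: "u \<in> V - {v, w}" for t u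
  proof -
    have sl: "slice (S v) t = {x v..x v + 1}" "slice (S w) t = {x w..x w + 1}"
      using mv mw vw by (auto simp: slice_def S usquare_def meets_def)
    have uv: "1 \<le> \<bar>x u - x v\<bar>" "1 \<le> \<bar>x u - x w\<bar>" if "meets y u t"
      using sep[of u v] sep[of u w] u vw that mv mw separated_meets by fastforce+
    have "(\<exists>a\<in>gap {x v..x v + 1} {x w..x w + 1}. x u < a \<and> a < x u + 1) \<longleftrightarrow> strictly_between x v w u"
      if m: "meets y u t"
    proof
      assume "\<exists>a\<in>gap {x v..x v + 1} {x w..x w + 1}. x u < a \<and> a < x u + 1"
      then show "strictly_between x v w u"
        using uv[OF m] by (auto simp: gap_unit_intervals strictly_between_def abs_if split: if_splits)
    next
      assume "strictly_between x v w u"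
      then have "x u + 1 / 2 \<in> gap {x v..x v + 1} {x w..x w + 1}"
        using uv[OF m] by (auto simp: gap_unit_intervals strictly_between_def abs_if split: if_splits)
      then show "\<exists>a\<in>gap {x v..x v + 1} {x w..x w + 1}. x u < a \<and> a < x u + 1"
        by force
    qed
    then show ?thesis
      using u unfolding sl by (auto simp: S in_interior_usquare)
  qed
  have hit: "(\<exists>a. (a, t) \<in> interior (S u)) \<longleftrightarrow> meets y u t" if "u \<in> V" for u t
  proof -
    have "x u < x u + 1 / 2 \<and> x u + 1 / 2 < x u + 1" by simp
    then show ?thesis
      using that by (auto simp only: S in_interior_usquare)
  qed
  have free: "(\<forall>u\<in>V - {v, w}. \<forall>a\<in>gap (slice (S v) t) (slice (S w) t). (a, t) \<notin> interior (S u))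
      \<longleftrightarrow> (\<forall>u\<in>V. meets y u t \<longrightarrow> \<not> strictly_between x v w u)"
    if "meets y v t" "meets y w t" for t
    using blocked[OF that] by (auto simp: strictly_between_def)
  show ?thesis
    unfolding horizontal_band_def sees_def hit[OF vw(1)] hit[OF vw(2)]
    using free by (metis (no_types, lifting))
qed

lemma swap_usquare: "prod.swap ` usquare x y v = usquare y x v"
  by (simp add: usquare_def product_swap)

lemma vertical_band_iff_sees:
  assumes S: "\<And>u. u \<in> V \<Longrightarrow> S u = usquare x y u"
    and sep: "\<And>u w. u \<in> V \<Longrightarrow> w \<in> V \<Longrightarrow> u \<noteq> w \<Longrightarrow> separated x y u w"
    and vw: "v \<in> V" "w \<in> V" "v \<noteq> w"
  shows "vertical_band V S v w \<longleftrightarrow> sees V y x v w"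
  unfolding vertical_band_def
  using assms by (intro horizontal_band_iff_sees) (auto simp: swap_usquare separated_commute)

lemma urv_representation_iff_sees:
  assumes S: "\<And>v. v \<in> pverts G \<Longrightarrow> S v = usquare x y v"
  shows "urv_representation G S \<longleftrightarrow>
     (\<forall>v\<in>pverts G. \<forall>w\<in>pverts G. v \<noteq> w \<longrightarrow> separated x y v w \<and>
        ((v, w) \<in> parcs G \<longleftrightarrow> sees (pverts G) x y v w \<or> sees (pverts G) y x v w))"
proof -
  let ?V = "pverts G"
  have sq: "\<forall>v\<in>?V. unit_square (S v)"
    by (auto simp: unit_square_def S usquare_def)
  have disj: "interior (S v) \<inter> interior (S w) = {} \<longleftrightarrow> separated x y v w"
    if "v \<in> ?V" "w \<in> ?V" for v w
    using that by (simp add: S interior_usquare_disjoint_iff)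
  have "(\<forall>v\<in>?V. \<forall>w\<in>?V. v \<noteq> w \<longrightarrow> interior (S v) \<inter> interior (S w) = {} \<and>
         ((v, w) \<in> parcs G \<longleftrightarrow> horizontal_band ?V S v w \<or> vertical_band ?V S v w)) \<longleftrightarrow>
      (\<forall>v\<in>?V. \<forall>w\<in>?V. v \<noteq> w \<longrightarrow> separated x y v w \<and>
         ((v, w) \<in> parcs G \<longleftrightarrow> sees ?V x y v w \<or> sees ?V y x v w))"
  \<comment> \<open>Bands reduce to \<open>sees\<close> only for separated squares; if some pair is
    not separated, both sides are false.\<close>
  proof (cases "\<forall>v\<in>?V. \<forall>w\<in>?V. v \<noteq> w \<longrightarrow> separated x y v w")
    case True
    then have sep: "separated x y u w" if "u \<in> ?V" "w \<in> ?V" "u \<noteq> w" for u w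
      using that by simp
    show ?thesis
    proof (intro ball_cong refl imp_cong conj_cong)
      fix v w assume vw: "v \<in> ?V" "w \<in> ?V" "v \<noteq> w"
      show "interior (S v) \<inter> interior (S w) = {} \<longleftrightarrow> separated x y v w"
        using disj vw by simp
      have "horizontal_band ?V S v w \<longleftrightarrow> sees ?V x y v w"
        by (rule horizontal_band_iff_sees[OF S sep vw])
      moreover have "vertical_band ?V S v w \<longleftrightarrow> sees ?V y x v w"
        by (rule vertical_band_iff_sees[OF S sep vw])
      ultimately show "((v, w) \<in> parcs G \<longleftrightarrow> horizontal_band ?V S v w \<or> vertical_band ?V S v w) \<longleftrightarrow>
          ((v, w) \<in> parcs G \<longleftrightarrow> sees ?V x y v w \<or> sees ?V y x v w)"
        by simp
    qed
  next
    case False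
    then obtain v w where "v \<in> ?V" "w \<in> ?V" "v \<noteq> w" "\<not> separated x y v w" by blast
    moreover from this have "interior (S v) \<inter> interior (S w) \<noteq> {}" using disj by simp
    ultimately show ?thesis by metis
  qed
  with sq show ?thesis
    unfolding urv_representation_def by simp
qed

lemma urv_representation_coordinates:
  assumes "urv_representation G S"
  shows "\<exists>x y. \<forall>v\<in>pverts G. S v = usquare x y v"
proof -
  have "\<forall>v\<in>pverts G. \<exists>p. S v = {fst p..fst p + 1} \<times> {snd p..snd p + 1}"
    using assms unfolding urv_representation_def unit_square_def by force
  then obtain p where "\<forall>v\<in>pverts G. S v = {fst (p v)..fst (p v) + 1} \<times> {snd (p v)..snd (p v) + 1}"
    by metis
  then have "\<forall>v\<in>pverts G. S v = usquare (fst \<circ> p) (snd \<circ> p) v"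
    by (simp add: usquare_def)
  then show ?thesis by blast
qed

section \<open>Horizontal visibility in a tree\<close>

lemma sees_sym: "sees V x y v w \<longleftrightarrow> sees V x y w v"
proof -
  have "strictly_between x v w = strictly_between x w v" by (auto simp: strictly_between_def)
  then show ?thesis by (auto simp: sees_def)
qed

lemma sees_overlap:
  assumes "sees V x y v w"
  shows "\<bar>y v - y w\<bar> < 1"
proof -
  obtain c d where "c < d" and "\<forall>t\<in>{c<..<d}. meets y v t \<and> meets y w t"
    using assms unfolding sees_def by blast
  then have "meets y v ((c + d) / 2)" "meets y w ((c + d) / 2)" by auto
  then show ?thesis by (auto simp: meets_def)
qed

definition connected_in :: "'a rel \<Rightarrow> 'a set \<Rightarrow> 'a \<Rightarrow> 'a \<Rightarrow> bool" where
  "connected_in E A v w \<longleftrightarrow> (v, w) \<in> (E \<inter> A \<times> A)\<^sup>*"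

lemma connected_in_trans:
  "connected_in E A u v \<Longrightarrow> connected_in E A v w \<Longrightarrow> connected_in E A u w"
  by (auto simp: connected_in_def)

lemma connected_in_sym:
  assumes "sym E" "connected_in E A u v"
  shows "connected_in E A v u"
proof -
  have "sym ((E \<inter> A \<times> A)\<^sup>*)"
    using assms(1) by (intro sym_rtrancl sym_Int) (auto intro: symI)
  then show ?thesis using assms(2) unfolding connected_in_def by (rule symD)
qed

text \<open>\<open>live N p u\<close>: the branch at \<open>u\<close> pointing away from \<open>p\<close> contains a vertex of degree at least 3.\<close>

inductive live :: "('a \<Rightarrow> 'a set) \<Rightarrow> 'a \<Rightarrow> 'a \<Rightarrow> bool" for N where
  live_here: "3 \<le> card (N u) \<Longrightarrow> live N p u"
| live_step: "w \<in> N u \<Longrightarrow> w \<noteq> p \<Longrightarrow> live N u w \<Longrightarrow> live N p u"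

text \<open>\<open>E\<close> holds the edges of both directions, and \<open>sees\<close> is only
  assumed to imply an edge, so the locale serves both directions after exchanging \<open>x\<close>
  and \<open>y\<close>. Acyclicity enters only as \<open>no_bypass\<close>.\<close>

locale visibility_tree =
  fixes V :: "'a set" and x y :: "'a \<Rightarrow> real" and E :: "'a rel"
  assumes finite_V: "finite V"
    and sep: "\<And>u w. u \<in> V \<Longrightarrow> w \<in> V \<Longrightarrow> u \<noteq> w \<Longrightarrow> separated x y u w"
    and sym_E: "sym E"
    and sees_imp_edge: "\<And>u w. u \<in> V \<Longrightarrow> w \<in> V \<Longrightarrow> u \<noteq> w \<Longrightarrow> sees V x y u w \<Longrightarrow> (u, w) \<in> E"
    and no_bypass: "\<And>u v w. (u, v) \<in> E \<Longrightarrow> (u, w) \<in> E \<Longrightarrow> connected_in E (V - {u}) v w \<Longrightarrow> v = w"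
begin

definition hnb :: "'a \<Rightarrow> 'a set" where
  "hnb u = {w \<in> V. w \<noteq> u \<and> u \<in> V \<and> sees V x y u w}"

definition generic :: "real \<Rightarrow> bool" where
  "generic t \<longleftrightarrow> (\<forall>v\<in>V. t \<noteq> y v \<and> t \<noteq> y v + 1)"

text \<open>Negating \<open>x\<close> reflects the picture up to a common shift, so results about
  the left of a square carry over to its right.\<close>

lemma mirror: "visibility_tree V (\<lambda>v. - x v) y E"
proof -
  have "strictly_between (\<lambda>v. - x v) v w = strictly_between x v w" for v w
    by (auto simp: strictly_between_def)
  then have sees: "sees V (\<lambda>v. - x v) y v w = sees V x y v w" for v w
    by (simp add: sees_def)
  have sep: "separated (\<lambda>v. - x v) y v w = separated x y v w" for v w
    by (auto simp: separated_def abs_minus_commute)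
  show ?thesis
    using visibility_tree_axioms unfolding visibility_tree_def sees sep .
qed

lemma mirror_hnb: "visibility_tree.hnb V (\<lambda>v. - x v) y = hnb"
proof -
  have "strictly_between (\<lambda>v. - x v) v w = strictly_between x v w" for v w
    by (auto simp: strictly_between_def)
  then have "sees V (\<lambda>v. - x v) y v w = sees V x y v w" for v w
    by (simp add: sees_def)
  then show ?thesis
    by (simp add: fun_eq_iff hnb_def visibility_tree.hnb_def[OF mirror])
qed

lemma hnb_sym: "v \<in> hnb u \<longleftrightarrow> u \<in> hnb v"
  by (auto simp: hnb_def sees_sym)

lemma finite_hnb: "finite (hnb u)"
  using finite_V by (simp add: hnb_def)

lemma hnb_edge: "v \<in> hnb u \<Longrightarrow> (u, v) \<in> E"
  by (auto simp: hnb_def intro: sees_imp_edge)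

lemma hnb_D:
  assumes "v \<in> hnb u"
  shows "u \<in> V" "v \<in> V" "v \<noteq> u" "\<bar>y v - y u\<bar> < 1" "x v \<noteq> x u"
proof -
  show "u \<in> V" "v \<in> V" "v \<noteq> u" "\<bar>y v - y u\<bar> < 1"
    using assms sees_overlap[of V x y u v] by (auto simp: hnb_def)
  with sep[of v u] show "x v \<noteq> x u" by (auto simp: separated_def)
qed

lemma ex_generic:
  assumes "c < d"
  obtains t where "c < t" "t < d" "generic t"
proof -
  have "finite (y ` V \<union> (\<lambda>v. y v + 1) ` V)" using finite_V by simp
  moreover have "infinite {c<..<d}" using assms by (simp add: infinite_Ioo)
  ultimately obtain t where "t \<in> {c<..<d} - (y ` V \<union> (\<lambda>v. y v + 1) ` V)"
    by (metis Diff_infinite_finite all_not_in_conv infinite_imp_nonempty)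
  then show thesis by (intro that[of t]) (auto simp: generic_def)
qed

lemma generic_stable:
  assumes "generic t"
  obtains e where "0 < e" "\<And>s v. \<bar>s - t\<bar> < e \<Longrightarrow> v \<in> V \<Longrightarrow> meets y v s \<longleftrightarrow> meets y v t"
proof -
  have "\<forall>\<^sub>F s in nhds t. meets y v s \<longleftrightarrow> meets y v t" if v: "v \<in> V" for v
  proof -
    consider "t \<in> {..<y v}" | "t \<in> {y v<..<y v + 1}" | "t \<in> {y v + 1<..}"
      using assms v unfolding generic_def by fastforce
    then obtain O' where "open O'" "t \<in> O'" "O' = {..<y v} \<or> O' = {y v<..<y v + 1} \<or> O' = {y v + 1<..}"
      by cases (metis open_lessThan, metis open_greaterThanLessThan, metis open_greaterThan)
    then show ?thesis
      by (intro eventually_mono[OF eventually_nhds_in_open[of O' t]]) (auto simp: meets_def)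
  qed
  then have "\<forall>\<^sub>F s in nhds t. \<forall>v\<in>V. meets y v s \<longleftrightarrow> meets y v t"
    using finite_V by (intro eventually_ball_finite) auto
  then show thesis
    unfolding eventually_nhds_metric dist_real_def using that by blast
qed

lemma consecutive_sees:
  assumes t: "generic t" "meets y u t" "meets y w t" and uw: "u \<in> V" "w \<in> V"
    and free: "\<And>z. z \<in> V \<Longrightarrow> meets y z t \<Longrightarrow> \<not> strictly_between x u w z"
  shows "sees V x y u w"
proof -
  obtain e where e: "0 < e"
    and stable: "\<And>s v. \<bar>s - t\<bar> < e \<Longrightarrow> v \<in> V \<Longrightarrow> meets y v s \<longleftrightarrow> meets y v t"
    using generic_stable[OF t(1)] by blast
  have "meets y u s \<and> meets y w s \<and> (\<forall>z\<in>V. meets y z s \<longrightarrow> \<not> strictly_between x u w z)"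
    if "s \<in> {t - e<..<t + e}" for s
  proof -
    have "\<bar>s - t\<bar> < e" using that by (auto simp: abs_if)
    from stable[OF this] show ?thesis using t(2,3) uw free by blast
  qed
  moreover have "t - e < t + e" using e by simp
  ultimately show ?thesis unfolding sees_def by blast
qed

text \<open>Squares that follow each other on a generic line see each other, so the stretch from
  \<open>u\<close> to \<open>w\<close> is a walk; induction on the number of squares strictly
  between the ends.\<close>

lemma line_connected:
  assumes t: "generic t" and uw: "u \<in> V" "w \<in> V" "meets y u t" "meets y w t" "x u \<le> x w"
    and A: "\<And>z. z \<in> V \<Longrightarrow> meets y z t \<Longrightarrow> x u \<le> x z \<Longrightarrow> x z \<le> x w \<Longrightarrow> z \<in> A"
  shows "connected_in E A u w"
  using uw A
proof (induction "card {z \<in> V. meets y z t \<and> x u < x z \<and> x z < x w}"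
    arbitrary: u w rule: less_induct)
  case less
  let ?M = "\<lambda>u w. {z \<in> V. meets y z t \<and> x u < x z \<and> x z < x w}"
  show ?case
  proof (cases "u = w")
    case True then show ?thesis by (simp add: connected_in_def)
  next
    case False
    show ?thesis
    proof (cases "?M u w = {}")
      case True
      then have "sees V x y u w"
        using less.prems by (intro consecutive_sees[OF t]) (auto simp: strictly_between_def)
      then have "(u, w) \<in> E" using less.prems False by (auto intro: sees_imp_edge)
      then have "(u, w) \<in> E \<inter> A \<times> A" using less.prems by auto
      then show ?thesis unfolding connected_in_def by (rule r_into_rtrancl)
    next
      case ne: False
      then obtain z where z: "z \<in> V" "meets y z t" "x u < x z" "x z < x w" by blast
      have fin: "finite (?M u w)" using finite_V by simp
      have "?M u z \<subset> ?M u w" using z by auto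
      then have 1: "connected_in E A u z"
        using less.prems z fin by (intro less.hyps psubset_card_mono) auto
      have "?M z w \<subset> ?M u w" using z by auto
      then have 2: "connected_in E A z w"
        using less.prems z fin by (intro less.hyps psubset_card_mono) auto
      from 1 2 show ?thesis by (rule connected_in_trans)
    qed
  qed
qed

text \<open>The neighbour is the next square to the left of \<open>u\<close> on the line; the
  stretch from \<open>z\<close> to it stays left of \<open>u\<close> and so avoids
  \<open>u\<close>.\<close>

lemma left_neighbour:
  assumes t: "generic t" and uz: "u \<in> V" "z \<in> V" "meets y u t" "meets y z t" "x z < x u"
  obtains v where "v \<in> hnb u" "x v < x u" "connected_in E (V - {u}) z v"
proof -
  let ?M = "{v \<in> V. meets y v t \<and> x v < x u}"
  have fin: "finite (x ` ?M)" using finite_V by simp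
  moreover have "x ` ?M \<noteq> {}" using uz by blast
  ultimately have "Max (x ` ?M) \<in> x ` ?M" by (rule Max_in)
  then obtain v where v: "v \<in> ?M" and "x v = Max (x ` ?M)" by auto
  with fin have max: "x w \<le> x v" if "w \<in> ?M" for w using that by simp
  have "sees V x y u v"
  proof (rule consecutive_sees[OF t])
    fix w assume w: "w \<in> V" "meets y w t"
    show "\<not> strictly_between x u v w"
    proof
      assume "strictly_between x u v w"
      then have "x v < x w" "x w < x u" using v by (auto simp: strictly_between_def)
      with max[of w] w show False by simp
    qed
  qed (use v uz in auto)
  then have "v \<in> hnb u" using v uz by (auto simp: hnb_def)
  moreover have "connected_in E (V - {u}) z v"
    using t uz v max[of z] by (intro line_connected[OF t]) auto
  ultimately show thesis using v that by auto
qed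

lemma right_neighbour:
  assumes t: "generic t" and uz: "u \<in> V" "z \<in> V" "meets y u t" "meets y z t" "x u < x z"
  obtains v where "v \<in> hnb u" "x u < x v" "connected_in E (V - {u}) z v"
proof -
  have "- x z < - x u" using uz(5) by simp
  then obtain v where "v \<in> hnb u" "- x v < - x u" "connected_in E (V - {u}) z v"
    by (rule visibility_tree.left_neighbour[OF mirror, unfolded mirror_hnb,
        OF t uz(1-4)])
  then show thesis using that by simp
qed

text \<open>
  The line at height \<open>t0\<close> joins \<open>z\<close> to \<open>w\<close> past \<open>u\<close>, while the other two lines join them to neighbours of
  \<open>u\<close> on opposite sides.
\<close>

lemma not_straddled_lines:
  assumes x: "x z < x u" "x u < x w" and V: "u \<in> V" "z \<in> V" "w \<in> V"
    and t0: "generic t0" "meets y z t0" "meets y w t0" "\<not> meets y u t0"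
    and t1: "generic t1" "meets y z t1" "meets y u t1"
    and t2: "generic t2" "meets y w t2" "meets y u t2"
  shows False
proof -
  obtain v where v: "v \<in> hnb u" "x v < x u" "connected_in E (V - {u}) z v"
    using left_neighbour[OF t1(1) V(1,2) t1(3,2) x(1)] .
  obtain v' where v': "v' \<in> hnb u" "x u < x v'" "connected_in E (V - {u}) w v'"
    using right_neighbour[OF t2(1) V(1,3) t2(3,2) x(2)] .
  have "connected_in E (V - {u}) z w"
    using x V t0 by (intro line_connected[OF t0(1)]) auto
  then have "connected_in E (V - {u}) v v'"
    by (intro connected_in_trans[OF connected_in_sym[OF sym_E v(3)] connected_in_trans[OF _ v'(3)]])
  then have "v = v'" by (rule no_bypass[OF hnb_edge[OF v(1)] hnb_edge[OF v'(1)]])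
  with v(2) v'(2) show False by simp
qed

text \<open>If both squares rise above \<open>u\<close>, a line just above the top of
  \<open>u\<close> meets both but misses \<open>u\<close>, and a line just below that top meets all
  three; this closes a cycle through \<open>u\<close>. The same happens below
  \<open>u\<close>.\<close>

lemma not_straddled:
  assumes x: "x z < x u" "x u < x w" and V: "u \<in> V" "z \<in> V" "w \<in> V"
    and near: "\<bar>y z - y u\<bar> < 1" "\<bar>y w - y u\<bar> < 1"
  shows "\<not> (y u < y z \<and> y u < y w)" "\<not> (y z < y u \<and> y w < y u)"
proof -
  show "\<not> (y u < y z \<and> y u < y w)"
  proof
    assume above: "y u < y z \<and> y u < y w"
    obtain t0 where "y u + 1 < t0" "t0 < min (y z) (y w) + 1" "generic t0"
    proof -
      have "y u + 1 < min (y z) (y w) + 1" using above by linarith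
      from ex_generic[OF this] that show ?thesis by blast
    qed
    moreover obtain t1 where "max (y z) (y w) < t1" "t1 < y u + 1" "generic t1"
    proof -
      have "max (y z) (y w) < y u + 1" using near by linarith
      from ex_generic[OF this] that show ?thesis by blast
    qed
    ultimately show False
      using above near by (intro not_straddled_lines[OF x V, of t0 t1 t1]) (auto simp: meets_def)
  qed
  show "\<not> (y z < y u \<and> y w < y u)"
  proof
    assume below: "y z < y u \<and> y w < y u"
    obtain t0 where "max (y z) (y w) < t0" "t0 < y u" "generic t0"
    proof -
      have "max (y z) (y w) < y u" using below by linarith
      from ex_generic[OF this] that show ?thesis by blast
    qed
    moreover obtain t1 where "y u < t1" "t1 < min (y z) (y w) + 1" "generic t1"
    proof -
      have "y u < min (y z) (y w) + 1" using near by linarith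
      from ex_generic[OF this] that show ?thesis by blast
    qed
    ultimately show False
      using below near by (intro not_straddled_lines[OF x V, of t0 t1 t1]) (auto simp: meets_def)
  qed
qed

text \<open>A generic line meeting both squares would join them without passing \<open>u\<close>,
  which lies to one side of the whole stretch.\<close>

lemma same_side_apart:
  assumes "v \<in> hnb u" "w \<in> hnb u" "v \<noteq> w" "x u < x v \<longleftrightarrow> x u < x w"
  shows "1 \<le> \<bar>y v - y w\<bar>"
proof (rule ccontr)
  assume "\<not> 1 \<le> \<bar>y v - y w\<bar>"
  then obtain t where "max (y v) (y w) < t" "t < min (y v) (y w) + 1" and t: "generic t"
  proof -
    have "max (y v) (y w) < min (y v) (y w) + 1" using \<open>\<not> 1 \<le> \<bar>y v - y w\<bar>\<close> by linarith
    from ex_generic[OF this] that show ?thesis by blast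
  qed
  then have m: "meets y v t" "meets y w t" by (auto simp: meets_def)
  have conn: "connected_in E (V - {u}) a b"
    if "{a, b} = {v, w}" "x a \<le> x b" for a b
  proof -
    have ab: "a \<in> hnb u" "b \<in> hnb u" "meets y a t" "meets y b t" "x u < x a \<longleftrightarrow> x u < x b"
      using that assms m by (auto simp: doubleton_eq_iff)
    show ?thesis
    proof (rule line_connected[OF t _ _ ab(3,4) that(2)])
      fix z assume "z \<in> V" "x a \<le> x z" "x z \<le> x b"
      then show "z \<in> V - {u}" using ab(5) hnb_D(5)[OF ab(1)] hnb_D(5)[OF ab(2)] by auto
    qed (use ab hnb_D(2) in auto)
  qed
  have "connected_in E (V - {u}) v w"
  proof (cases "x v \<le> x w")
    case True then show ?thesis by (rule conn[OF refl])
  next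
    case False
    then have "connected_in E (V - {u}) w v" by (intro conn[OF insert_commute]) simp
    then show ?thesis by (rule connected_in_sym[OF sym_E])
  qed
  then have "v = w" by (rule no_bypass[OF hnb_edge[OF assms(1)] hnb_edge[OF assms(2)]])
  with assms(3) show False by simp
qed

section \<open>Degree bound and dead branches\<close>

definition side :: "bool \<Rightarrow> 'a \<Rightarrow> 'a set" where
  "side r u = {v \<in> hnb u. (x u < x v) = r}"

lemma hnb_sides: "hnb u = side True u \<union> side False u" "side True u \<inter> side False u = {}"
  by (auto simp: side_def)

lemma finite_side: "finite (side r u)"
  using finite_hnb by (simp add: side_def)

text \<open>Three neighbours on one side would give three heights, pairwise at least 1 apart, in an
  open interval of length 2.\<close>

lemma card_side_le_2: "card (side r u) \<le> 2"
proof (rule ccontr)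
  assume "\<not> card (side r u) \<le> 2"
  then have "3 \<le> card (side r u)" by simp
  then obtain S where "S \<subseteq> side r u" "card S = 3"
    by (rule obtain_subset_with_card_n)
  then obtain a b c where abc: "a \<in> side r u" "b \<in> side r u" "c \<in> side r u" "a \<noteq> b" "b \<noteq> c" "a \<noteq> c"
    by (auto simp: card_3_iff)
  then have "1 \<le> \<bar>y a - y b\<bar>" "1 \<le> \<bar>y b - y c\<bar>" "1 \<le> \<bar>y a - y c\<bar>"
    using same_side_apart[of _ u] unfolding side_def by blast+
  moreover have "\<bar>y a - y u\<bar> < 1" "\<bar>y b - y u\<bar> < 1" "\<bar>y c - y u\<bar> < 1"
    using abc hnb_D(4) by (auto simp: side_def)
  ultimately show False by linarith
qed

lemma two_on_side:
  assumes "2 \<le> card (side r u)"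
  obtains U D where "U \<in> side r u" "D \<in> side r u" "y D < y u" "y u < y U"
proof -
  obtain S where "S \<subseteq> side r u" "card S = 2"
    using obtain_subset_with_card_n[OF assms] by blast
  then obtain a b where ab: "a \<in> side r u" "b \<in> side r u" "a \<noteq> b"
    by (auto simp: card_2_iff)
  then have "1 \<le> \<bar>y a - y b\<bar>" using same_side_apart[of a u b] by (auto simp: side_def)
  moreover have "\<bar>y a - y u\<bar> < 1" "\<bar>y b - y u\<bar> < 1"
    using ab hnb_D(4) by (auto simp: side_def)
  ultimately have "y a < y u \<and> y u < y b \<or> y b < y u \<and> y u < y a" by linarith
  then show thesis using ab that by blast
qed

lemma sides_not_both_two: "card (side r u) < 2 \<or> card (side (\<not> r) u) < 2"
proof (rule ccontr)
  assume "\<not> ?thesis"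
  then have two: "2 \<le> card (side True u)" "2 \<le> card (side False u)" by (cases r; simp)+
  obtain U where U: "U \<in> side True u" "y u < y U" using two_on_side[OF two(1)] by blast
  obtain U' where U': "U' \<in> side False u" "y u < y U'" using two_on_side[OF two(2)] by blast
  have nb: "U \<in> hnb u" "x u < x U" "U' \<in> hnb u" using U U' by (auto simp: side_def)
  have "x U' < x u" using U' hnb_D(5)[OF nb(3)] by (auto simp: side_def)
  from not_straddled(1)[OF this nb(2) hnb_D(1)[OF nb(1)] hnb_D(2)[OF nb(3)] hnb_D(2)[OF nb(1)]
      hnb_D(4)[OF nb(3)] hnb_D(4)[OF nb(1)]]
  show False using U U' by blast
qed

lemma card_hnb: "card (hnb u) = card (side True u) + card (side False u)"
  using hnb_sides[of u] finite_side by (simp add: card_Un_disjoint)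

lemma card_hnb_le_3: "card (hnb u) \<le> 3"
  using card_hnb[of u] card_side_le_2[of True u] card_side_le_2[of False u]
    sides_not_both_two[of True u] by auto

text \<open>The two neighbours on the right lie above and below \<open>u\<close>, so a square to the
  left that overlaps \<open>u\<close> in height would straddle \<open>u\<close> with one of them
  unless it has exactly the height of \<open>u\<close>. A vertex cannot have two aligned neighbours
  on one side, so the branch remains a path running left.\<close>

lemma two_right_imp_dead_left:
  assumes two: "2 \<le> card (side True u)" and X: "X \<in> side False u"
  shows "\<not> live hnb u X"
proof -
  obtain U D where UD: "U \<in> side True u" "D \<in> side True u" "y D < y u" "y u < y U"
    using two_on_side[OF two] .
  have aligned: "y z = y u" if z: "z \<in> V" "x z < x u" "\<bar>y z - y u\<bar> < 1" for z
  proof -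
    have nb: "U \<in> hnb u" "x u < x U" "D \<in> hnb u" "x u < x D" using UD by (auto simp: side_def)
    have "\<not> (y u < y z \<and> y u < y U)"
      using not_straddled(1)[OF z(2) nb(2) hnb_D(1)[OF nb(1)] z(1) hnb_D(2)[OF nb(1)] z(3)
          hnb_D(4)[OF nb(1)]] .
    moreover have "\<not> (y z < y u \<and> y D < y u)"
      using not_straddled(2)[OF z(2) nb(4) hnb_D(1)[OF nb(3)] z(1) hnb_D(2)[OF nb(3)] z(3)
          hnb_D(4)[OF nb(3)]] .
    ultimately show ?thesis using UD by linarith
  qed
  \<comment> \<open>Generalized from \<open>u\<close> and \<open>X\<close> to every edge from
    \<open>p\<close> to \<open>q\<close> that leads left at the height of \<open>u\<close>, so that
    the induction can follow the derivation of \<open>live\<close>.\<close>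
  have dead: "False"
    if "live hnb p q" "q \<in> hnb p" "x q < x p" "x p \<le> x u" "y p = y u" for p q
    using that
  proof induction
    case (live_here q p)
    note q = live_here(2-)
    have yq: "y q = y u" using aligned[of q] hnb_D[OF q(1)] q by auto
    have left: "y w = y u" if "w \<in> side False q" for w
      using that aligned[of w] hnb_D[of w q] q yq by (auto simp: side_def)
    have right: "side True q \<subseteq> {p}"
    proof
      fix w assume w: "w \<in> side True q"
      show "w \<in> {p}"
      proof (rule ccontr)
        assume "w \<notin> {p}"
        then have "1 \<le> \<bar>y w - y p\<bar>"
          using w q by (intro same_side_apart[of _ q]) (auto simp: side_def hnb_sym)
        then show False using hnb_D(4)[of w q] w yq q by (auto simp: side_def)
      qed
    qed
    have "card (side False q) < 2"
    proof (rule ccontr)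
      assume "\<not> card (side False q) < 2"
      then obtain U D where "U \<in> side False q" "y q < y U"
        using two_on_side[of False q] by (metis not_less)
      then show False using left yq by fastforce
    qed
    moreover have "card (side True q) \<le> 1"
      using card_mono[OF _ right] by simp
    ultimately show False using live_here(1) card_hnb[of q] by simp
  next
    case (live_step w q p)
    note q = live_step(5-)
    have yq: "y q = y u" using aligned[of q] hnb_D[OF q(1)] q by auto
    have "x w < x q"
    proof (rule ccontr)
      assume "\<not> x w < x q"
      then have "1 \<le> \<bar>y w - y p\<bar>"
        using live_step(1,2) q hnb_D(5)[of w q]
        by (intro same_side_apart[of _ q]) (auto simp: side_def hnb_sym)
      then show False using hnb_D(4)[of w q] live_step(1) yq q by auto
    qed
    then show False using live_step.IH live_step(1) q yq by auto
  qed
  show ?thesis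
    using dead[of u X] X hnb_D(5)[of X u] by (auto simp: side_def)
qed

lemma two_left_imp_dead_right:
  assumes two: "2 \<le> card (side False u)" and X: "X \<in> side True u"
  shows "\<not> live hnb u X"
proof -
  have "visibility_tree.side V (\<lambda>v. - x v) y r u = side (\<not> r) u" for r
  proof -
    have "x v < x u \<longleftrightarrow> \<not> x u < x v" if "v \<in> hnb u" for v
      using hnb_D(5)[OF that] by linarith
    then show ?thesis
      by (auto simp: visibility_tree.side_def[OF mirror] side_def mirror_hnb)
  qed
  then show ?thesis
    using visibility_tree.two_right_imp_dead_left[OF mirror, of u X] two X by (simp add: mirror_hnb)
qed

lemma ex_dead:
  assumes "3 \<le> card (hnb u)"
  obtains X where "X \<in> hnb u" "\<not> live hnb u X"
proof -
  have "2 \<le> card (side True u) \<and> 1 \<le> card (side False u) \<or>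
      2 \<le> card (side False u) \<and> 1 \<le> card (side True u)"
    using assms card_hnb[of u] card_side_le_2[of True u] card_side_le_2[of False u] by linarith
  then obtain r where r: "2 \<le> card (side r u)" "1 \<le> card (side (\<not> r) u)" by auto
  then obtain X where X: "X \<in> side (\<not> r) u" by fastforce
  then have "\<not> live hnb u X"
    using r two_right_imp_dead_left two_left_imp_dead_right by (cases r) auto
  with X that show thesis by (auto simp: side_def)
qed

end

section \<open>Counting paths in two families of caterpillars\<close>

text \<open>
  Walks that never step straight back, of length \<open>i\<close>, starting at \<open>u\<close> and having arrived from \<open>p\<close>.
\<close>

primrec path_count :: "('a \<Rightarrow> 'a set) \<Rightarrow> nat \<Rightarrow> 'a \<Rightarrow> 'a \<Rightarrow> nat" where
  "path_count N 0 p u = 1"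
| "path_count N (Suc i) p u = (\<Sum>w\<in>N u - {p}. path_count N i u w)"

lemma sum_le_card_mult:
  fixes f :: "'a \<Rightarrow> nat"
  assumes "\<And>w. w \<in> A \<Longrightarrow> f w \<le> K" "card A \<le> m"
  shows "sum f A \<le> m * K"
proof -
  have "sum f A \<le> card A * K" using sum_bounded_above[of A f K] assms(1) by simp
  also have "\<dots> \<le> m * K" using assms(2) by simp
  finally show ?thesis .
qed

text \<open>The degree bound and \<open>ex_dead\<close> are what is kept of the geometry: at a
  vertex of degree 3 at most two branches are live.\<close>

locale caterpillar =
  fixes N :: "'a \<Rightarrow> 'a set"
  assumes finite_N: "finite (N u)"
    and sym_N: "v \<in> N u \<Longrightarrow> u \<in> N v"
    and card_N_le_3: "card (N u) \<le> 3"
    and ex_dead: "3 \<le> card (N u) \<Longrightarrow> \<exists>X\<in>N u. \<not> live N u X"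
begin

lemma card_minus: "p \<in> N u \<Longrightarrow> card (N u - {p}) = card (N u) - 1"
  using finite_N by simp

text \<open>With no vertex of degree 3 ahead there is always at most one way to go on.\<close>

lemma path_count_dead:
  assumes "\<not> live N p u" "p \<in> N u"
  shows "path_count N i p u \<le> 1"
  using assms
proof (induction i arbitrary: p u)
  case (Suc i)
  have "card (N u) < 3" using Suc.prems(1) live_here[of N u p] by fastforce
  then have "card (N u - {p}) \<le> 1" using card_minus[OF Suc.prems(2)] by simp
  moreover have "path_count N i u w \<le> 1" if "w \<in> N u - {p}" for w
    using that Suc.prems(1) live_step[of w N u p] sym_N by (intro Suc.IH) auto
  ultimately have "(\<Sum>w\<in>N u - {p}. path_count N i u w) \<le> 1 * 1"
    by (intro sum_le_card_mult) auto
  then show ?case by simp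
qed simp

text \<open>A vertex of degree 3 lies behind, so at a branching the dead branch given by
  \<open>ex_dead\<close> must be one of the two ahead. It adds at most one path, and the other
  branch satisfies the same hypothesis.\<close>

lemma path_count_spine:
  assumes "live N u p" "p \<in> N u"
  shows "path_count N i p u \<le> i + 1"
  using assms
proof (induction i arbitrary: p u)
  case (Suc i)
  have IH: "path_count N i u w \<le> i + 1" if "w \<in> N u - {p}" for w
    using that Suc.prems live_step[of p N u w] sym_N by (intro Suc.IH) auto
  show ?case
  proof (cases "3 \<le> card (N u)")
    case False
    then have "card (N u - {p}) \<le> 1" using card_minus[OF Suc.prems(2)] by simp
    then have "(\<Sum>w\<in>N u - {p}. path_count N i u w) \<le> 1 * (i + 1)"
      using IH by (intro sum_le_card_mult) auto
    then show ?thesis by simp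
  next
    case True
    then obtain X where X: "X \<in> N u" "\<not> live N u X" using ex_dead by blast
    with Suc.prems have X': "X \<in> N u - {p}" by auto
    have "card (N u - {p} - {X}) \<le> 1"
      using X' card_minus[OF Suc.prems(2)] card_N_le_3[of u] finite_N[of u] by simp
    then have "(\<Sum>w\<in>N u - {p} - {X}. path_count N i u w) \<le> 1 * (i + 1)"
      using IH by (intro sum_le_card_mult) auto
    moreover have "path_count N i u X \<le> 1"
      using X sym_N by (intro path_count_dead) auto
    ultimately show ?thesis
      using sum.remove[of "N u - {p}" X "path_count N i u"] X' finite_N by simp
  qed
qed simp

text \<open>Nothing is known about what lies behind. Up to the first branching there is one way to
  go; that vertex then lies behind both branches, so \<open>path_count_spine\<close> bounds each of
  them.\<close>

lemma path_count_le:
  assumes "p \<in> N u"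
  shows "path_count N i p u \<le> 2 * i + 1"
  using assms
proof (induction i arbitrary: p u)
  case (Suc i)
  show ?case
  proof (cases "3 \<le> card (N u)")
    case False
    then have "card (N u - {p}) \<le> 1" using card_minus[OF Suc.prems] by simp
    then have "(\<Sum>w\<in>N u - {p}. path_count N i u w) \<le> 1 * (2 * i + 1)"
      using Suc.IH sym_N by (intro sum_le_card_mult) auto
    then show ?thesis by simp
  next
    case True
    have "card (N u - {p}) \<le> 2" using card_minus[OF Suc.prems] card_N_le_3[of u] by simp
    moreover have "path_count N i u w \<le> i + 1" if "w \<in> N u - {p}" for w
      using that True sym_N by (intro path_count_spine live_here) auto
    ultimately have "(\<Sum>w\<in>N u - {p}. path_count N i u w) \<le> 2 * (i + 1)"
      by (intro sum_le_card_mult) auto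
    then show ?thesis by simp
  qed
qed simp

text \<open>The extreme case is degree 3: a dead branch gives 1 and the two others at most
  \<open>i + 1\<close> each, as \<open>u\<close> itself is a branching behind them. With two
  neighbours, either both branches are live and each has the other behind it, or one is
  dead.\<close>

lemma sum_path_count_le: "(\<Sum>w\<in>N u. path_count N i u w) \<le> 2 * i + 3"
proof -
  have with_dead: ?thesis
    if X: "X \<in> N u" "\<not> live N u X"
      and K: "\<And>w. w \<in> N u - {X} \<Longrightarrow> path_count N i u w \<le> K"
      and m: "card (N u) \<le> Suc m" "m * K \<le> 2 * i + 2" for X m K
  proof -
    have "card (N u - {X}) \<le> m" using card_minus[OF X(1)] m(1) by simp
    then have "(\<Sum>w\<in>N u - {X}. path_count N i u w) \<le> m * K"
      using K by (intro sum_le_card_mult) auto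
    moreover have "path_count N i u X \<le> 1" using X sym_N by (intro path_count_dead) auto
    ultimately show ?thesis
      using sum.remove[OF finite_N X(1), of "path_count N i u"] m(2) by simp
  qed
  consider "card (N u) \<le> 1" | "card (N u) = 2" | "3 \<le> card (N u)" by linarith
  then show ?thesis
  proof cases
    case 1
    then have "(\<Sum>w\<in>N u. path_count N i u w) \<le> 1 * (2 * i + 1)"
      using path_count_le sym_N by (intro sum_le_card_mult) auto
    then show ?thesis by simp
  next
    case 2
    show ?thesis
    proof (cases "\<forall>w\<in>N u. live N u w")
      case True
      have "live N w u" if w: "w \<in> N u" for w
      proof -
        have "card (N u - {w}) = 1" using card_minus[OF w] 2 by simp
        then obtain w' where "w' \<in> N u - {w}" by (metis card.empty all_not_in_conv zero_neq_one)
        then show ?thesis using True by (auto intro: live_step)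
      qed
      then have "(\<Sum>w\<in>N u. path_count N i u w) \<le> 2 * (i + 1)"
        using 2 sym_N by (intro sum_le_card_mult path_count_spine) auto
      then show ?thesis by simp
    next
      case False
      then obtain X where X: "X \<in> N u" "\<not> live N u X" by blast
      show ?thesis
        by (rule with_dead[OF X, of "2 * i + 1" 1]) (use 2 path_count_le sym_N in auto)
    qed
  next
    case 3
    then obtain X where X: "X \<in> N u" "\<not> live N u X" using ex_dead by blast
    have "path_count N i u w \<le> i + 1" if "w \<in> N u - {X}" for w
      using that 3 sym_N by (intro path_count_spine live_here) auto
    then show ?thesis
      by (rule with_dead[OF X, of "i + 1" 2]) (use card_N_le_3[of u] in auto)
  qed
qed

end

section \<open>The recurrence for the bound\<close>

text \<open>The \<open>D k\<close> of the overview: a summand stands for a first run of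
  \<open>i + 1\<close> edges of one colour, with at most \<open>2 * i + 3\<close> ends, followed by
  \<open>k - i\<close> edges beginning with the other colour.\<close>

fun half_level :: "nat \<Rightarrow> nat" where
  "half_level 0 = 1"
| "half_level (Suc k) = (\<Sum>i\<le>k. (2 * i + 3) * half_level (k - i))"

text \<open>Shifting the sum by one raises each coefficient \<open>2 * i + 3\<close> by 2, so the
  previous convolution reappears and leaves a plain prefix sum. Up to a factor, that prefix sum is
  the auxiliary sequence \<open>a\<close>.\<close>

lemma half_level_Suc_Suc:
  "half_level (Suc (Suc k)) = 4 * half_level (Suc k) + 2 * (\<Sum>i\<le>k. half_level (k - i))"
proof -
  have "half_level (Suc (Suc k)) =
      3 * half_level (Suc k) + (\<Sum>i\<le>k. (2 * Suc i + 3) * half_level (k - i))"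
    by (simp only: half_level.simps(2)[of "Suc k"] sum.atMost_Suc_shift) simp
  also have "(\<Sum>i\<le>k. (2 * Suc i + 3) * half_level (k - i)) =
      (\<Sum>i\<le>k. (2 * i + 3) * half_level (k - i) + 2 * half_level (k - i))"
    by (intro sum.cong) (auto simp: algebra_simps)
  also have "\<dots> = half_level (Suc k) + 2 * (\<Sum>i\<le>k. half_level (k - i))"
    by (simp add: sum.distrib sum_distrib_left)
  finally show ?thesis by simp
qed

lemma recurrence_half_level:
  fixes a c :: "nat \<Rightarrow> nat"
  assumes init: "a 1 = 4" "c 1 = 6"
    and a: "\<And>k. k \<ge> 2 \<Longrightarrow> a k = a (k - 1) + 2 * c (k - 1)"
    and c: "\<And>k. k \<ge> 2 \<Longrightarrow> c k = a (k - 1) + 4 * c (k - 1)"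
  shows "c (Suc k) = 2 * half_level (Suc k) \<and> a (Suc k) = 4 * (\<Sum>i\<le>k. half_level (k - i))"
proof (induction k)
  case 0
  show ?case using init by simp
next
  case (Suc k)
  have "(\<Sum>i\<le>Suc k. half_level (Suc k - i)) = half_level (Suc k) + (\<Sum>i\<le>k. half_level (k - i))"
    by (subst sum.atMost_Suc_shift) simp
  moreover have "a (Suc (Suc k)) = a (Suc k) + 2 * c (Suc k)"
    "c (Suc (Suc k)) = a (Suc k) + 4 * c (Suc k)"
    using a[of "Suc (Suc k)"] c[of "Suc (Suc k)"] by simp_all
  ultimately show ?case
    using Suc.IH half_level_Suc_Suc[of k] by (simp del: half_level.simps)
qed

section \<open>Walks alternating between two caterpillars\<close>

primrec reach :: "('a \<Rightarrow> 'a set) \<Rightarrow> nat \<Rightarrow> 'a \<Rightarrow> 'a \<Rightarrow> 'a set" where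
  "reach N 0 p u = {u}"
| "reach N (Suc k) p u = (\<Union>w\<in>N u - {p}. reach N k u w)"

lemma finite_reach: "(\<And>u. finite (N u)) \<Longrightarrow> finite (reach N k p u)"
  by (induction k arbitrary: p u) auto

locale two_caterpillars = A: caterpillar A + B: caterpillar B
  for A B :: "'a \<Rightarrow> 'a set"
begin

abbreviation "AB u \<equiv> A u \<union> B u"

lemma card_reach_UN_A:
  assumes "\<And>u p. p \<in> A u \<Longrightarrow> card (reach AB k p u) \<le> (\<Sum>i\<le>k. path_count A i p u * half_level (k - i))"
    and "W \<subseteq> A u"
  shows "card (\<Union>w\<in>W. reach AB k u w) \<le>
    (\<Sum>i\<le>k. (\<Sum>w\<in>W. path_count A i u w) * half_level (k - i))"
proof -
  have W: "finite W" using assms(2) A.finite_N finite_subset by blast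
  have "card (\<Union>w\<in>W. reach AB k u w) \<le> (\<Sum>w\<in>W. card (reach AB k u w))"
    using W by (rule card_UN_le)
  also have "\<dots> \<le> (\<Sum>w\<in>W. \<Sum>i\<le>k. path_count A i u w * half_level (k - i))"
    using assms A.sym_N by (intro sum_mono) auto
  also have "\<dots> = (\<Sum>i\<le>k. (\<Sum>w\<in>W. path_count A i u w) * half_level (k - i))"
    by (subst sum.swap) (simp add: sum_distrib_right)
  finally show ?thesis .
qed

lemma card_reach_UN_A_le:
  assumes "\<And>u p. p \<in> A u \<Longrightarrow> card (reach AB k p u) \<le> (\<Sum>i\<le>k. path_count A i p u * half_level (k - i))"
  shows "card (\<Union>w\<in>A u. reach AB k u w) \<le> half_level (Suc k)"
proof -
  have "card (\<Union>w\<in>A u. reach AB k u w) \<le>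
    (\<Sum>i\<le>k. (\<Sum>w\<in>A u. path_count A i u w) * half_level (k - i))"
    by (rule card_reach_UN_A[OF assms]) auto
  also have "\<dots> \<le> (\<Sum>i\<le>k. (2 * i + 3) * half_level (k - i))"
    by (intro sum_mono mult_right_mono A.sum_path_count_le) auto
  finally show ?thesis by simp
qed

text \<open>Having arrived along an edge of \<open>A\<close>, the walk stays in \<open>A\<close> for
  exactly \<open>i\<close> more steps and then changes to \<open>B\<close>. The term
  \<open>i = 0\<close>, an immediate change, is bounded by the hypothesis on \<open>B\<close>; the
  others come from the previous length.\<close>

lemma card_reach_A_Suc:
  assumes A: "\<And>u p. p \<in> A u \<Longrightarrow> card (reach AB k p u) \<le> (\<Sum>i\<le>k. path_count A i p u * half_level (k - i))"
    and B: "\<And>u. card (\<Union>w\<in>B u. reach AB k u w) \<le> half_level (Suc k)"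
  shows "card (reach AB (Suc k) p u) \<le> (\<Sum>i\<le>Suc k. path_count A i p u * half_level (Suc k - i))"
proof -
  let ?X = "\<Union>w\<in>A u - {p}. reach AB k u w" and ?Y = "\<Union>w\<in>B u. reach AB k u w"
  have fin: "finite (reach AB k v w)" for v w
    using A.finite_N B.finite_N by (intro finite_reach) auto
  have "card (reach AB (Suc k) p u) \<le> card (?X \<union> ?Y)"
    using fin A.finite_N B.finite_N by (intro card_mono) auto
  also have "\<dots> \<le> card ?X + card ?Y" by (rule card_Un_le)
  also have "card ?X \<le> (\<Sum>i\<le>k. (\<Sum>w\<in>A u - {p}. path_count A i u w) * half_level (k - i))"
    by (rule card_reach_UN_A[OF A]) auto
  also have "card ?Y \<le> half_level (Suc k)" by (rule B)
  finally show ?thesis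
    by (simp add: sum.atMost_Suc_shift del: sum.atMost_Suc half_level.simps(2))
qed

end

text \<open>Provides every bound with the colours exchanged; the rewrite keeps both versions about
  the same function \<open>AB\<close>.\<close>

sublocale two_caterpillars \<subseteq> swapped: two_caterpillars B A
  rewrites "(\<lambda>u. B u \<union> A u) = (\<lambda>u. A u \<union> B u)"
  by unfold_locales (auto simp: Un_commute)

context two_caterpillars
begin

text \<open>The colours need a common induction, because a change of colour uses the bound for the
  other colour at a shorter length.\<close>

lemma card_reach_le:
  "(\<forall>u. \<forall>p\<in>A u. card (reach AB k p u) \<le> (\<Sum>i\<le>k. path_count A i p u * half_level (k - i))) \<and>
   (\<forall>u. \<forall>p\<in>B u. card (reach AB k p u) \<le> (\<Sum>i\<le>k. path_count B i p u * half_level (k - i)))"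
proof (induction k)
  case (Suc k)
  then show ?case
    using card_reach_A_Suc[of k] swapped.card_reach_A_Suc[of k]
      card_reach_UN_A_le[of k] swapped.card_reach_UN_A_le[of k] by blast
qed simp

lemma card_level_le: "card (\<Union>w\<in>A u \<union> B u. reach AB k u w) \<le> 2 * half_level (Suc k)"
proof -
  have "card (\<Union>w\<in>A u \<union> B u. reach AB k u w) \<le>
      card (\<Union>w\<in>A u. reach AB k u w) + card (\<Union>w\<in>B u. reach AB k u w)"
    by (simp add: UN_Un card_Un_le)
  also have "\<dots> \<le> half_level (Suc k) + half_level (Suc k)"
    using card_reach_le[of k] by (intro add_mono card_reach_UN_A_le swapped.card_reach_UN_A_le) auto
  finally show ?thesis by simp
qed

end

section \<open>The upper bound\<close>

lemma (in wf_digraph) unit_\<mu>_eq_iff: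
  "\<mu> (\<lambda>_. 1) u v = ereal (real k) \<longleftrightarrow>
     (\<exists>p. awalk u p v \<and> length p = k) \<and> (\<forall>p. awalk u p v \<longrightarrow> k \<le> length p)"
proof -
  have cost: "awalk_cost (\<lambda>_. 1) p = real (length p)" for p :: "'b list"
    by (induction p) auto
  have least: "\<mu> (\<lambda>_. 1) u v = ereal (real m)"
    if "awalk u q v" "length q = m" "\<And>p. awalk u p v \<Longrightarrow> m \<le> length p" for q m
  proof (rule antisym)
    show "\<mu> (\<lambda>_. 1) u v \<le> ereal (real m)"
      using min_cost_le_walk_cost[OF that(1), of "\<lambda>_. 1"] that(2) by (simp add: cost)
    show "ereal (real m) \<le> \<mu> (\<lambda>_. 1) u v"
      unfolding \<mu>_def using that(3) by (intro INF_greatest) (auto simp: cost)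
  qed
  show ?thesis
  proof
    assume k: "\<mu> (\<lambda>_. 1) u v = ereal (real k)"
    then have "\<exists>q. awalk u q v"
      using shortest_path_inf[of u v "\<lambda>_. 1"] by (auto simp: reachable_awalk)
    then obtain q where q: "awalk u q v" "\<And>p. awalk u p v \<Longrightarrow> length q \<le> length p"
      using ex_has_least_nat[of "\<lambda>q. awalk u q v" _ length] by blast
    then have "k = length q" using least[OF q(1) refl q(2)] k by simp
    with q show "(\<exists>p. awalk u p v \<and> length p = k) \<and> (\<forall>p. awalk u p v \<longrightarrow> k \<le> length p)"
      by blast
  qed (use least in blast)
qed

text \<open>Reduction to a path keeps only arcs of the walk, and a path repeats no arc, so it is not
  longer than the walk.\<close>

lemma (in wf_digraph) shortest_awalk_apath:
  assumes "awalk u p v" "\<And>q. awalk u q v \<Longrightarrow> length p \<le> length q"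
  obtains q where "apath u q v" "length q = length p"
proof -
  let ?q = "awalk_to_apath p"
  have q: "apath u ?q v" using assms(1) by (rule apath_awalk_to_apath)
  then have "distinct ?q"
    using distinct_tl_verts_imp_distinct[of u ?q v] by (auto simp: apath_def distinct_tl)
  then have "length ?q = card (set ?q)" by (simp add: distinct_card)
  also have "\<dots> \<le> card (set p)"
    using awalk_to_apath_subset[OF assms(1)] by (intro card_mono) auto
  also have "\<dots> \<le> length p" by (rule card_length)
  finally have "length ?q = length p" using assms(2)[of ?q] q by (auto simp: apath_def)
  with q show thesis by (rule that)
qed

text \<open>A path from \<open>v\<close> to \<open>w\<close> avoiding \<open>u\<close> closes to a
  cycle through \<open>u\<close>, of length at least 3 because v \<noteq> w makes the path
  nonempty.\<close>

lemma undirected_tree_no_bypass: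
  assumes T: "undirected_tree T" and uv: "(u, v) \<in> parcs T" "(u, w) \<in> parcs T"
    and conn: "connected_in (parcs T) (pverts T - {u}) v w"
  shows "v = w"
proof (rule ccontr)
  assume "v \<noteq> w"
  interpret T: pair_graph T using T by (simp add: undirected_tree_def)
  let ?A = "parcs T \<inter> (pverts T - {u}) \<times> (pverts T - {u})"
  have v: "v \<in> pverts T" using uv T.wellformed' by blast
  have "\<exists>q. T.awalk v q w \<and> set q \<subseteq> ?A"
    using conn unfolding connected_in_def
  proof (induction rule: rtrancl_induct)
    case base
    then show ?case using v by (intro exI[of _ "[]"]) (simp add: T.awalk_Nil_iff)
  next
    case (step y z)
    then obtain q where "T.awalk v q y" "set q \<subseteq> ?A" by blast
    moreover have "T.awalk y [(y, z)] z"
      using step.hyps T.wellformed' by (auto simp: T.awalk_simps)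
    ultimately show ?case
      using step.hyps(2) by (intro exI[of _ "q @ [(y, z)]"]) (auto intro: T.awalk_appendI)
  qed
  then obtain q where q: "T.awalk v q w" "set q \<subseteq> ?A" by blast
  define r where "r = T.awalk_to_apath q"
  have r: "T.apath v r w" "set r \<subseteq> ?A"
    using T.apath_awalk_to_apath[OF q(1)] T.awalk_to_apath_subset[OF q(1)] q(2)
    unfolding r_def by auto
  then have "r \<noteq> []" using \<open>v \<noteq> w\<close> by (auto simp: T.apath_Nil_iff)
  have rw: "T.awalk v r w" "distinct (pawalk_verts v r)" using r(1) by (auto simp: T.apath_def)
  have "u \<notin> set (pawalk_verts v r)"
    using T.set_awalk_verts[OF rw(1)] r(2) uv T.no_loops' by fastforce
  moreover have "pawalk_verts v (r @ [(w, u)]) = pawalk_verts v r @ [u]"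
    using \<open>r \<noteq> []\<close> rw(1) T.awalk_verts_append[of v r "[(w, u)]" u] uv T.arcs_symmetric T.wellformed'
    by (auto simp: T.awalk_simps)
  ultimately have "distinct (tl (pawalk_verts u ((u, v) # r @ [(w, u)])))"
    using rw(2) by simp
  moreover have "T.awalk u ((u, v) # r @ [(w, u)]) u"
    using rw(1) uv T.arcs_symmetric T.wellformed' by (auto simp: T.awalk_simps)
  ultimately have "T.cycle ((u, v) # r @ [(w, u)])" by (auto simp: T.cycle_def)
  moreover have "3 \<le> length ((u, v) # r @ [(w, u)])" using \<open>r \<noteq> []\<close> by (cases r) auto
  ultimately show False using T by (auto simp: undirected_tree_def)
qed

text \<open>Distinctness, with the predecessor \<open>q\<close> included, rules out every step
  straight back.\<close>

lemma (in pair_wf_digraph) apath_in_reach: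
  assumes "awalk u p v" "distinct (q # pawalk_verts u p)"
  shows "v \<in> reach (\<lambda>u. {w. (u, w) \<in> parcs G}) (length p) q u"
  using assms
proof (induction p arbitrary: u q)
  case Nil
  then show ?case by (simp add: awalk_Nil_iff)
next
  case (Cons e p)
  then have e: "e = (u, snd e)" "(u, snd e) \<in> parcs G" and p: "awalk (snd e) p v"
    by (auto simp: awalk_Cons_iff)
  have "snd e \<in> set (pawalk_verts (snd e) p)" using p hd_in_awalk_verts by blast
  then have "q \<noteq> snd e" using Cons.prems(2) by auto
  moreover have "v \<in> reach (\<lambda>u. {w. (u, w) \<in> parcs G}) (length p) u (snd e)"
    using Cons.prems Cons.IH[OF p, of u] by (auto simp: awalk_Cons_iff)
  ultimately show ?case using e(2) by auto
qed

lemma verts_at_depth_subset_reach: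
  assumes "pair_wf_digraph T"
  defines "N \<equiv> \<lambda>u. {w. (u, w) \<in> parcs T}"
  shows "verts_at_depth T r (Suc k) \<subseteq> (\<Union>w\<in>N r. reach N k r w)"
proof
  interpret T: pair_wf_digraph T by fact
  fix v assume "v \<in> verts_at_depth T r (Suc k)"
  then have "T.\<mu> (\<lambda>_. 1) r v = ereal (real (Suc k))"
    by (simp add: verts_at_depth_def depth_def)
  then obtain p where p: "T.awalk r p v" "length p = Suc k"
    "\<And>q. T.awalk r q v \<Longrightarrow> Suc k \<le> length q"
    unfolding T.unit_\<mu>_eq_iff by blast
  then obtain q where q: "T.apath r q v" "length q = Suc k"
    using T.shortest_awalk_apath[of r p v] by metis
  then obtain e s where qe: "q = e # s" by (cases q) auto
  then have e: "e = (r, snd e)" "(r, snd e) \<in> parcs T"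
    and s: "T.awalk (snd e) s v" "distinct (r # pawalk_verts (snd e) s)" "length s = k"
    using q by (auto simp: T.awalk_Cons_iff T.apath_def)
  have "v \<in> reach N (length s) r (snd e)"
    unfolding N_def by (rule T.apath_in_reach[OF s(1,2)])
  then show "v \<in> (\<Union>w\<in>N r. reach N k r w)" using e(2) s(3) by (auto simp: N_def)
qed

theorem card_verts_at_depth_le:
  assumes T: "rooted_tree T r" and U: "URVG T"
  shows "card (verts_at_depth T r (Suc k)) \<le> 2 * half_level (Suc k)"
proof -
  have tree: "undirected_tree T" using T by (simp add: rooted_tree_def)
  interpret T: pair_graph T using tree by (simp add: undirected_tree_def)
  obtain S where S: "urv_representation T S" using U by (auto simp: URVG_def)
  obtain x y where xy: "\<forall>v\<in>pverts T. S v = usquare x y v"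
    using urv_representation_coordinates[OF S] by blast
  have rep: "separated x y v w \<and>
      ((v, w) \<in> parcs T \<longleftrightarrow> sees (pverts T) x y v w \<or> sees (pverts T) y x v w)"
    if "v \<in> pverts T" "w \<in> pverts T" "v \<noteq> w" for v w
    using S urv_representation_iff_sees[of T S x y] xy that by blast
  have sym: "sym (parcs T)" using T.arcs_symmetric by (auto intro: symI)
  interpret H: visibility_tree "pverts T" x y "parcs T"
    by unfold_locales
      (use rep sym undirected_tree_no_bypass[OF tree] in \<open>simp_all\<close>)
  interpret V: visibility_tree "pverts T" y x "parcs T"
    by unfold_locales
      (use rep sym undirected_tree_no_bypass[OF tree] separated_commute[of x y] in \<open>simp_all\<close>)
  interpret two_caterpillars H.hnb V.hnb
    by unfold_locales
      (use H.finite_hnb V.finite_hnb H.hnb_sym V.hnb_sym H.card_hnb_le_3 V.card_hnb_le_3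
        H.ex_dead V.ex_dead in \<open>blast+\<close>)
  have N: "{w. (u, w) \<in> parcs T} = H.hnb u \<union> V.hnb u" for u
  proof (intro equalityI subsetI)
    fix w assume "w \<in> {w. (u, w) \<in> parcs T}"
    then have "u \<in> pverts T" "w \<in> pverts T" "u \<noteq> w" "(u, w) \<in> parcs T"
      using T.wellformed' T.no_loops' by blast+
    then show "w \<in> H.hnb u \<union> V.hnb u"
      using rep[of u w] unfolding H.hnb_def V.hnb_def by blast
  next
    fix w assume "w \<in> H.hnb u \<union> V.hnb u"
    then show "w \<in> {w. (u, w) \<in> parcs T}"
      using H.hnb_edge[of w u] V.hnb_edge[of w u] by blast
  qed
  have sub: "verts_at_depth T r (Suc k) \<subseteq> (\<Union>w\<in>H.hnb r \<union> V.hnb r. reach AB k r w)"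
    using verts_at_depth_subset_reach[OF T.pair_wf_digraph, of r k] by (simp only: N)
  have fin: "finite (\<Union>w\<in>H.hnb r \<union> V.hnb r. reach AB k r w)"
    using H.finite_hnb V.finite_hnb by (auto intro!: finite_reach)
  from card_mono[OF fin sub] card_level_le[of k r] show ?thesis by (rule order_trans)
qed

section \<open>Words and their positions in the zigzag layout\<close>

text \<open>
  A vertex is a natural number read in base 8: its parent is \<open>n div 8\<close>, and the digit \<open>n mod 8\<close> says how
  it is attached. Axis \<open>q = 0\<close> (horizontal edges) uses the digits 1, 2, 3 and axis \<open>q = 3\<close> (vertical
  edges) the digits 4, 5, 6; in this order they mean spine upwards, spine downwards, and leg.
\<close>

definition allowed :: "nat \<Rightarrow> nat \<Rightarrow> bool" where
  "allowed d e \<longleftrightarrow> 1 \<le> e \<and> e \<le> 6 \<and>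
     (\<forall>q\<in>{0, 3}. q < d \<and> d \<le> q + 3 \<and> q < e \<and> e \<le> q + 3 \<longrightarrow> e = d \<or> e = q + 3)"

inductive_set words :: "nat set" where
  zero: "0 \<in> words"
| child: "n div 8 \<in> words \<Longrightarrow> allowed (n div 8 mod 8) (n mod 8) \<Longrightarrow> n \<in> words"

definition on_axis :: "nat \<Rightarrow> nat \<Rightarrow> bool" where
  "on_axis q n \<longleftrightarrow> q < n mod 8 \<and> n mod 8 \<le> q + 3"

lemma div8_less [termination_simp]:
  "on_axis q n \<Longrightarrow> n div 8 < n" "n mod 8 = q + 3 \<Longrightarrow> n div 8 < n"
  by (cases "n = 0"; simp add: on_axis_def)+

fun comp_root :: "nat \<Rightarrow> nat \<Rightarrow> nat" where
  "comp_root q n = (if on_axis q n then comp_root q (n div 8) else n)"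

fun row_root :: "nat \<Rightarrow> nat \<Rightarrow> nat" where
  "row_root q n = (if n mod 8 = q + 3 then row_root q (n div 8) else n)"

fun row_index :: "nat \<Rightarrow> nat \<Rightarrow> int" where
  "row_index q n = (if on_axis q n
     then row_index q (n div 8) + (if n mod 8 = q + 1 then 1 else if n mod 8 = q + 2 then -1 else 0)
     else 0)"

text \<open>
  Along axis \<open>q\<close> the vertices of a component are ordered by \<open>pos q\<close>. Its root has row 0 and hence
  counts as the innermost vertex on the negative side.
\<close>

definition dir :: "nat \<Rightarrow> nat \<Rightarrow> int" where
  "dir q n = (if even (row_index q n) then -1 else 1)"

definition pos :: "nat \<Rightarrow> nat \<Rightarrow> int" where
  "pos q n = dir q n * int n"

text \<open>
  Coordinates are in units of half a side, and \<open>coord M 0\<close> is the height, \<open>coord M 3\<close> the abscissa. A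
  component root is attached along the other axis \<open>3 - q\<close>, whose order therefore fixes its coordinate.
\<close>

definition coord :: "int \<Rightarrow> nat \<Rightarrow> nat \<Rightarrow> int" where
  "coord M q n = M * pos (3 - q) (comp_root q n) + row_index q n"

text \<open>A closed form, so that component and row alone determine the innermost vertex of a
  row.\<close>

definition spine :: "nat \<Rightarrow> nat \<Rightarrow> int \<Rightarrow> nat" where
  "spine q h j = (if 0 \<le> j then ((\<lambda>n. 8 * n + q + 1) ^^ nat j) h
     else ((\<lambda>n. 8 * n + q + 2) ^^ nat (- j)) h)"

declare comp_root.simps [simp del] row_root.simps [simp del] row_index.simps [simp del]

lemma off_axis_simps:
  assumes "\<not> on_axis q n"
  shows "comp_root q n = n" "row_index q n = 0" "row_root q n = n"
  subgoal by (subst comp_root.simps) (simp add: assms)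
  subgoal by (subst row_index.simps) (simp add: assms)
  subgoal using assms by (subst row_root.simps) (auto simp: on_axis_def)
  done

lemma on_axis_simps:
  assumes "on_axis q n"
  shows "comp_root q n = comp_root q (n div 8)"
    "n mod 8 = q + 1 \<Longrightarrow> row_index q n = row_index q (n div 8) + 1"
    "n mod 8 = q + 2 \<Longrightarrow> row_index q n = row_index q (n div 8) - 1"
    "n mod 8 = q + 3 \<Longrightarrow> row_index q n = row_index q (n div 8)"
  subgoal by (subst comp_root.simps) (simp add: assms)
  subgoal by (subst row_index.simps) (simp add: assms)
  subgoal by (subst row_index.simps) (simp add: assms)
  subgoal by (subst row_index.simps) (simp add: assms)
  done

lemma row_root_simps:
  "n mod 8 \<noteq> q + 3 \<Longrightarrow> row_root q n = n"
  "n mod 8 = q + 3 \<Longrightarrow> row_root q n = row_root q (n div 8)"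
  subgoal by (subst row_root.simps) simp
  subgoal by (subst row_root.simps) simp
  done

lemma comp_root_le: "comp_root q n \<le> n"
proof (induction q n rule: comp_root.induct)
  case (1 q n)
  then show ?case using div8_less(1)[of q n] by (subst comp_root.simps) auto
qed

lemma row_root_le: "row_root q n \<le> n"
proof (induction q n rule: row_root.induct)
  case (1 q n)
  then show ?case using div8_less(2)[of n q] by (subst row_root.simps) auto
qed

text \<open>Each step down multiplies by 8 and adds a nonzero digit; the factor gives
  \<open>coord_order\<close> its slack.\<close>

lemma comp_root_less:
  assumes "comp_root q n \<noteq> n"
  shows "8 * comp_root q n < n"
proof -
  have n: "on_axis q n" "comp_root q n = comp_root q (n div 8)"
    using assms by (metis comp_root.simps)+
  then have "comp_root q n \<le> n div 8" using comp_root_le by simp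
  moreover have "n = 8 * (n div 8) + n mod 8" by simp
  moreover have "0 < n mod 8" using n(1) by (simp add: on_axis_def)
  ultimately show ?thesis by linarith
qed

lemma not_on_axis_comp_root: "\<not> on_axis q (comp_root q n)"
proof (induction q n rule: comp_root.induct)
  case (1 q n)
  then show ?case by (subst comp_root.simps) auto
qed

lemma row_comp_root: "row_index q (comp_root q n) = 0"
  by (rule off_axis_simps(2)[OF not_on_axis_comp_root])

lemma leg_same_row:
  assumes "n mod 8 = q + 3"
  shows "comp_root q n = comp_root q (n div 8)" "row_index q n = row_index q (n div 8)"
  using on_axis_simps(1,4)[of q n] assms by (simp_all add: on_axis_def)

lemma row_root_same_row: "comp_root q (row_root q n) = comp_root q n" "row_index q (row_root q n) = row_index q n"
proof (induction q n rule: row_root.induct)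
  case (1 q n)
  {
    case 1
    then show ?case using "1.IH"(1) leg_same_row[of n q] by (subst row_root.simps) auto
  next
    case 2
    then show ?case using "1.IH"(2) leg_same_row[of n q] by (subst row_root.simps) auto
  }
qed

lemma abs_row_le: "\<bar>row_index q n\<bar> \<le> int n"
proof (induction q n rule: row_index.induct)
  case (1 q n)
  show ?case
  proof (cases "on_axis q n")
    case True
    then have "int (n div 8) + 1 \<le> int n" using div8_less(1)[OF True] by linarith
    then show ?thesis using 1 True by (subst row_index.simps) auto
  qed (simp add: row_index.simps)
qed

lemma dir_cases: "dir q n = 1 \<or> dir q n = -1"
  by (simp add: dir_def)

lemma abs_pos: "\<bar>pos q n\<bar> = int n"
  using dir_cases[of q n] by (auto simp: pos_def abs_mult)

lemma pos_inj: "pos q n = pos q m \<Longrightarrow> n = m"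
  by (metis abs_pos of_nat_eq_iff)

lemma words_div: "n \<in> words \<Longrightarrow> n div 8 \<in> words"
  by (cases rule: words.cases) (auto intro: words.zero)

lemma words_allowed:
  assumes "n \<in> words" "n \<noteq> 0"
  shows "allowed (n div 8 mod 8) (n mod 8)"
  using assms by cases auto

lemma words_axis:
  assumes "n \<in> words" "n \<noteq> 0"
  shows "on_axis 0 n \<or> on_axis 3 n" "\<not> (on_axis 0 n \<and> on_axis 3 n)"
  using words_allowed[OF assms] by (auto simp: allowed_def on_axis_def)

lemma spine_zero: "spine q h 0 = h"
  by (simp add: spine_def)

lemma spine_up: "0 \<le> j \<Longrightarrow> spine q h (j + 1) = 8 * spine q h j + q + 1"
  by (simp add: spine_def nat_add_distrib)

lemma spine_down: "j \<le> 0 \<Longrightarrow> spine q h (j - 1) = 8 * spine q h j + q + 2"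
proof -
  assume "j \<le> 0"
  then have "nat (- (j - 1)) = Suc (nat (- j))" by simp
  with \<open>j \<le> 0\<close> show ?thesis by (cases "j = 0") (auto simp: spine_def)
qed

text \<open>The two sign claims strengthen the induction: the spine never turns round, and the sign
  of the parent's row decides whether \<open>spine_up\<close> or \<open>spine_down\<close>
  applies.\<close>

lemma row_root_spine:
  assumes "n \<in> words" "q \<in> {0, 3}"
  shows "row_root q n = spine q (comp_root q n) (row_index q n) \<and>
    (n mod 8 = q + 1 \<longrightarrow> 0 < row_index q n) \<and> (n mod 8 = q + 2 \<longrightarrow> row_index q n < 0)"
  using assms(1)
proof induction
  case zero
  have "\<not> on_axis q 0" by (simp add: on_axis_def)
  then show ?case by (simp add: off_axis_simps spine_zero)
next
  case (child n)
  let ?p = "n div 8" and ?d = "n div 8 mod 8" and ?e = "n mod 8"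
  have n: "n = 8 * ?p + ?e" by simp
  consider "?e = q + 3" | "?e = q + 1" | "?e = q + 2" | "\<not> on_axis q n"
    unfolding on_axis_def by linarith
  then show ?case
  proof cases
    case 1
    then show ?thesis
      using child.IH leg_same_row[OF 1] 1 by (simp add: row_root_simps)
  next
    case 2
    then have ax: "on_axis q n" by (simp add: on_axis_def)
    have d: "?d = q + 1 \<or> \<not> on_axis q ?p"
      using child.hyps(2) 2 assms(2) unfolding allowed_def on_axis_def by auto
    have nonneg: "0 \<le> row_index q ?p" using d child.IH off_axis_simps(2)[of q ?p] by auto
    have "row_root q ?p = ?p" using d by (intro row_root_simps) (auto simp: on_axis_def)
    then have "?p = spine q (comp_root q ?p) (row_index q ?p)" using child.IH by simp
    moreover have "row_index q n = row_index q ?p + 1" "comp_root q n = comp_root q ?p"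
      using 2 by (simp_all add: on_axis_simps[OF ax])
    moreover have "row_root q n = n" using 2 by (simp add: row_root_simps)
    ultimately show ?thesis using spine_up[OF nonneg, of q "comp_root q ?p"] nonneg 2 n by auto
  next
    case 3
    then have ax: "on_axis q n" by (simp add: on_axis_def)
    have d: "?d = q + 2 \<or> \<not> on_axis q ?p"
      using child.hyps(2) 3 assms(2) unfolding allowed_def on_axis_def by auto
    have nonpos: "row_index q ?p \<le> 0" using d child.IH off_axis_simps(2)[of q ?p] by auto
    have "row_root q ?p = ?p" using d by (intro row_root_simps) (auto simp: on_axis_def)
    then have "?p = spine q (comp_root q ?p) (row_index q ?p)" using child.IH by simp
    moreover have "row_index q n = row_index q ?p - 1" "comp_root q n = comp_root q ?p"
      using 3 by (simp_all add: on_axis_simps[OF ax])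
    moreover have "row_root q n = n" using 3 by (simp add: row_root_simps)
    ultimately show ?thesis using spine_down[OF nonpos, of q "comp_root q ?p"] nonpos 3 n by auto
  next
    case 4
    then show ?thesis
      by (auto simp: off_axis_simps spine_zero) (auto simp: on_axis_def)
  qed
qed

text \<open>A row is a chain of successive leg children of increasing size, so a smaller member of
  the row of \<open>m\<close> is at most the parent of \<open>m\<close>.\<close>

lemma row_chain:
  assumes "row_root q n = row_root q m" "n < m"
  shows "m mod 8 = q + 3 \<and> n \<le> m div 8"
  using assms
proof (induction m arbitrary: n rule: less_induct)
  case (less m)
  have leg: "m mod 8 = q + 3"
    using less.prems row_root_le[of q n] row_root_simps(1)[of m q] by (metis leD)
  have "n \<le> m div 8"
  proof (rule ccontr)
    assume "\<not> n \<le> m div 8"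
    then have "m div 8 < n" by simp
    moreover have "row_root q (m div 8) = row_root q n"
      using leg less.prems(1) by (simp add: row_root_simps)
    ultimately have "n mod 8 = q + 3" "m div 8 \<le> n div 8"
      using less.IH[of n "m div 8"] less.prems(2) by auto
    then have "m \<le> n"
      using leg div_mult_mod_eq[of m 8] div_mult_mod_eq[of n 8] by linarith
    with less.prems(2) show False by simp
  qed
  with leg show ?case ..
qed

section \<open>Visibility in the zigzag layout\<close>

locale layout =
  fixes V :: "nat set" and M :: int
  assumes V_words: "V \<subseteq> words"
    and V_div: "n \<in> V \<Longrightarrow> n div 8 \<in> V"
    and M_large: "n \<in> V \<Longrightarrow> 2 * int n + 3 \<le> M"
begin


lemma row_root_V: "n \<in> V \<Longrightarrow> row_root q n \<in> V"
proof (induction q n rule: row_root.induct)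
  case (1 q n)
  then show ?case using V_div by (subst row_root.simps) auto
qed

lemma M_ge_3: "n \<in> V \<Longrightarrow> 3 \<le> M"
  using M_large[of n] by simp

text \<open>Different components are offset by at least \<open>M\<close>, and by
  \<open>M_large\<close> their row indices, bounded by the vertex numbers, cannot make up for
  that.\<close>

lemma near_same_comp:
  assumes nm: "n \<in> V" "m \<in> V" and near: "\<bar>coord M q n - coord M q m\<bar> \<le> 1"
  shows "comp_root q n = comp_root q m" "coord M q n - coord M q m = row_index q n - row_index q m"
proof -
  let ?d = "pos (3 - q) (comp_root q n) - pos (3 - q) (comp_root q m)"
  have "?d = 0"
  proof (rule ccontr)
    assume "?d \<noteq> 0"
    then have "M * 1 \<le> M * \<bar>?d\<bar>"
      using M_ge_3[OF nm(1)] by (intro mult_left_mono) auto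
    also have "\<dots> = \<bar>M * ?d\<bar>" using M_ge_3[OF nm(1)] by (simp add: abs_mult)
    also have "M * ?d = coord M q n - coord M q m - row_index q n + row_index q m"
      by (simp add: coord_def algebra_simps)
    finally have "M \<le> 1 + int n + int m"
      using near abs_row_le[of q n] abs_row_le[of q m] by linarith
    then show False using M_large[OF nm(1)] M_large[OF nm(2)] by linarith
  qed
  then show root: "comp_root q n = comp_root q m" by (intro pos_inj[of "3 - q"]) simp
  then show "coord M q n - coord M q m = row_index q n - row_index q m" by (simp add: coord_def)
qed

lemma on_axis_other:
  assumes "n \<in> V" "q \<in> {0, 3}" "on_axis q n"
  shows "\<not> on_axis (3 - q) n"
  using words_axis(2)[of n] assms V_words by (cases "n = 0") (auto simp: on_axis_def)

lemma coord_other_axis: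
  assumes "n \<in> V" "q \<in> {0, 3}" "on_axis q n"
  shows "coord M (3 - q) n = M * pos q n"
  using off_axis_simps[OF on_axis_other[OF assms]] assms(2) by (auto simp: coord_def)

text \<open>A vertex other than the root \<open>?h\<close> is the root of its own component on the
  other axis, hence has coordinate exactly \<open>M * pos q n\<close>. The root \<open>?h\<close>
  was placed by another component, but within \<open>M * ?h + ?h\<close> of the origin, while all
  other members exceed \<open>8 * ?h\<close>. So \<open>?h\<close> lies in the middle wherever it
  is.\<close>

lemma coord_order:
  assumes nm: "n \<in> V" "m \<in> V" and q: "q \<in> {0, 3}"
    and root: "comp_root q n = comp_root q m" and less: "pos q n < pos q m"
  shows "coord M (3 - q) n + 2 \<le> coord M (3 - q) m"
proof -
  note M3 = M_ge_3[OF nm(1)]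
  let ?h = "comp_root q n"
  have onax: "on_axis q k" if "comp_root q k \<noteq> k" for k
    using that off_axis_simps(1) by blast
  have root_bound: "\<bar>coord M (3 - q) ?h\<bar> \<le> M * int ?h + int ?h"
  proof -
    have "\<bar>M * pos (3 - (3 - q)) (comp_root (3 - q) ?h)\<bar> = M * int (comp_root (3 - q) ?h)"
      using M3 by (simp add: abs_mult abs_pos)
    also have "\<dots> \<le> M * int ?h" using M3 comp_root_le by (intro mult_left_mono) auto
    finally show ?thesis
      using abs_row_le[of "3 - q" ?h] unfolding coord_def by linarith
  qed
  have far: "M * int ?h + int ?h + 2 \<le> M * int k" if "8 * ?h < k" for k
  proof -
    have "M * (8 * int ?h + 1) \<le> M * int k" using that M3 by (intro mult_left_mono) auto
    moreover have "1 * int ?h \<le> M * int ?h" using M3 by (intro mult_right_mono) auto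
    ultimately show ?thesis using M3 by (simp add: algebra_simps)
  qed
  have root_pos: "pos q ?h = - int ?h"
    using row_comp_root[of q n] by (simp add: pos_def dir_def)
  consider "n = ?h" "m = ?h" | "n = ?h" "m \<noteq> ?h" | "n \<noteq> ?h" "m = ?h" | "n \<noteq> ?h" "m \<noteq> ?h"
    by blast
  then show ?thesis
  proof cases
    case 1
    then have "n = m" by simp
    with less show ?thesis by simp
  next
    case 2
    then have m: "8 * ?h < m" using comp_root_less[of q m] root by auto
    have "pos q m = int m"
    proof (rule ccontr)
      assume "pos q m \<noteq> int m"
      then have "pos q m = - int m" using dir_cases[of q m] by (auto simp: pos_def)
      moreover have "pos q n = - int ?h" using root_pos 2 by simp
      ultimately show False using less m by simp
    qed
    then have "coord M (3 - q) m = M * int m"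
      using coord_other_axis[OF nm(2) q onax] 2 root by simp
    moreover have "coord M (3 - q) n = coord M (3 - q) ?h" using 2 by simp
    ultimately show ?thesis using far[OF m] root_bound by linarith
  next
    case 3
    then have n: "8 * ?h < n" using comp_root_less[of q n] by auto
    have "pos q n = - int n"
    proof (rule ccontr)
      assume "pos q n \<noteq> - int n"
      then have "pos q n = int n" using dir_cases[of q n] by (auto simp: pos_def)
      moreover have "pos q m = - int ?h" using root_pos 3 by simp
      ultimately show False using less n by simp
    qed
    then have "coord M (3 - q) n = - (M * int n)"
      using coord_other_axis[OF nm(1) q onax] 3 by simp
    moreover have "coord M (3 - q) m = coord M (3 - q) ?h" using 3 by simp
    ultimately show ?thesis using far[OF n] root_bound by linarith
  next
    case 4
    then have "coord M (3 - q) n = M * pos q n" "coord M (3 - q) m = M * pos q m"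
      using coord_other_axis[OF nm(1) q onax] coord_other_axis[OF nm(2) q onax] root by simp_all
    moreover have "M * 1 \<le> M * (pos q m - pos q n)"
      using M3 less by (intro mult_left_mono) auto
    ultimately show ?thesis using M3 by (simp add: algebra_simps)
  qed
qed

lemma coord_less_iff:
  assumes "n \<in> V" "m \<in> V" "q \<in> {0, 3}" "comp_root q n = comp_root q m"
  shows "coord M (3 - q) n < coord M (3 - q) m \<longleftrightarrow> pos q n < pos q m"
  using coord_order[OF assms] coord_order[OF assms(2,1,3) assms(4)[symmetric]] pos_inj[of q n m]
  by (cases "pos q n" "pos q m" rule: linorder_cases) auto

lemma same_row_root:
  assumes "n \<in> V" "m \<in> V" "q \<in> {0, 3}" "comp_root q n = comp_root q m" "row_index q n = row_index q m"
  shows "row_root q n = row_root q m"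
proof -
  have "n \<in> words" "m \<in> words" using assms V_words by auto
  then show ?thesis using row_root_spine[of n q] row_root_spine[of m q] assms by simp
qed

definition coordinate :: "nat \<Rightarrow> nat \<Rightarrow> real" where
  "coordinate q n = coord M q n / 2"

lemma meets_coordinate:
  fixes t :: real
  shows "meets (coordinate q) n t \<longleftrightarrow> coord M q n < 2 * t \<and> 2 * t < coord M q n + 2"
  by (auto simp: meets_def coordinate_def)

lemma strictly_between_coordinate:
  assumes "n \<in> V" "m \<in> V" "w \<in> V" "q \<in> {0, 3}"
    "comp_root q n = comp_root q w" "comp_root q m = comp_root q w"
  shows "strictly_between (coordinate (3 - q)) n m w \<longleftrightarrow>
    pos q n < pos q w \<and> pos q w < pos q m \<or> pos q m < pos q w \<and> pos q w < pos q n"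
  using assms coord_less_iff[of n w q] coord_less_iff[of w n q]
    coord_less_iff[of m w q] coord_less_iff[of w m q]
  by (simp add: strictly_between_def coordinate_def)

lemma meets_near:
  assumes "meets (coordinate q) n t" "meets (coordinate q) m t"
  shows "\<bar>coord M q n - coord M q m\<bar> \<le> 1"
proof -
  have "real_of_int (coord M q n) < coord M q m + 2" "real_of_int (coord M q m) < coord M q n + 2"
    using assms unfolding meets_coordinate by linarith+
  then show ?thesis by linarith
qed

text \<open>If the parent of \<open>m\<close> were not \<open>n\<close>, it would lie in the same
  row strictly between the two and block the view.\<close>

lemma sees_same_row:
  assumes nm: "n \<in> V" "m \<in> V" "n < m" and q: "q \<in> {0, 3}"
    and row: "comp_root q n = comp_root q m" "row_index q n = row_index q m"
    and t: "meets (coordinate q) n t" "meets (coordinate q) m t"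
    and free: "\<And>w. w \<in> V \<Longrightarrow> meets (coordinate q) w t \<Longrightarrow> \<not> strictly_between (coordinate (3 - q)) n m w"
  shows "m div 8 = n" "on_axis q m"
proof -
  have chain: "m mod 8 = q + 3" "n \<le> m div 8"
    using row_chain[OF same_row_root[OF nm(1,2) q row] nm(3)] by blast+
  then show "on_axis q m" by (simp add: on_axis_def)
  show "m div 8 = n"
  proof (rule ccontr)
    assume "m div 8 \<noteq> n"
    let ?w = "m div 8"
    have w: "n < ?w" "?w < m" "?w \<in> V"
      using chain \<open>?w \<noteq> n\<close> div8_less(2)[OF chain(1)] V_div nm by auto
    have rw: "comp_root q ?w = comp_root q m" "row_index q ?w = row_index q m"
      using leg_same_row[OF chain(1)] by simp_all
    then have "meets (coordinate q) ?w t"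
      using t(2) by (simp add: meets_coordinate coord_def)
    then have nb: "\<not> strictly_between (coordinate (3 - q)) n m ?w" using free w(3) by blast
    have "dir q ?w = dir q m" "dir q n = dir q m" using rw row by (simp_all add: dir_def)
    then have "pos q n < pos q ?w \<and> pos q ?w < pos q m \<or> pos q m < pos q ?w \<and> pos q ?w < pos q n"
      using w dir_cases[of q m] by (auto simp: pos_def)
    then show False
      using nb strictly_between_coordinate[OF nm(1,2) w(3) q trans[OF row(1) rw(1)[symmetric]]
          rw(1)[symmetric]] by blast
  qed
qed

text \<open>Adjacent rows extend in opposite directions, so a square that is not innermost is hidden
  behind the innermost one of its row. The innermost squares of adjacent rows are consecutive spine
  vertices.\<close>

lemma sees_next_row:
  assumes nm: "n \<in> V" "m \<in> V" and q: "q \<in> {0, 3}"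
    and row: "comp_root q n = comp_root q m" "row_index q m = row_index q n + 1"
    and t: "meets (coordinate q) n t" "meets (coordinate q) m t"
    and free: "\<And>w. w \<in> V \<Longrightarrow> meets (coordinate q) w t \<Longrightarrow> \<not> strictly_between (coordinate (3 - q)) n m w"
  shows "m div 8 = n \<and> on_axis q m \<or> n div 8 = m \<and> on_axis q n"
proof -
  have innermost: "row_root q a = a"
    if ab: "a \<in> V" "meets (coordinate q) a t" "comp_root q a = comp_root q b" "b \<in> V"
      and dir: "dir q b = - dir q a" and nb: "\<And>w. w \<in> V \<Longrightarrow> meets (coordinate q) w t \<Longrightarrow>
        \<not> strictly_between (coordinate (3 - q)) a b w" for a b
  proof (rule ccontr)
    assume ne: "row_root q a \<noteq> a"
    let ?w = "row_root q a"
    have w: "?w < a" "?w \<in> V" using ne row_root_le[of q a] row_root_V[OF ab(1)] by auto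
    have same: "comp_root q ?w = comp_root q a" "row_index q ?w = row_index q a"
      by (rule row_root_same_row)+
    then have "meets (coordinate q) ?w t" using ab(2) by (simp add: meets_coordinate coord_def)
    then have "\<not> strictly_between (coordinate (3 - q)) a b ?w" using nb w(2) by blast
    moreover have "pos q a < pos q ?w \<and> pos q ?w < pos q b \<or> pos q b < pos q ?w \<and> pos q ?w < pos q a"
    proof -
      have "pos q ?w = dir q a * int ?w" "pos q b = - dir q a * int b"
        using same dir by (simp_all add: pos_def dir_def)
      \<comment> \<open>Needed for strictness: position 0 has no sign. As the rows of
        \<open>?w\<close> and \<open>b\<close> have opposite directions, these cannot both be the
        vertex 0.\<close>
      moreover have "0 < ?w \<or> 0 < b"
      proof (rule ccontr)
        assume "\<not> ?thesis"
        then have "row_index q ?w = 0" "row_index q b = 0" using abs_row_le[of q ?w] abs_row_le[of q b] by auto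
        then show False using same dir by (simp add: dir_def)
      qed
      ultimately show ?thesis using w(1) dir_cases[of q a] by (auto simp: pos_def)
    qed
    ultimately show False
      using strictly_between_coordinate[OF ab(1,4) w(2) q same(1)[symmetric]
          trans[OF ab(3)[symmetric] same(1)[symmetric]]] by blast
  qed
  have "dir q m = - dir q n" using row(2) by (simp add: dir_def)
  moreover have "strictly_between (coordinate (3 - q)) m n w = strictly_between (coordinate (3 - q)) n m w" for w
    by (auto simp: strictly_between_def)
  ultimately have "row_root q n = n" "row_root q m = m"
    using innermost[of n m] innermost[of m n] nm row t free by auto
  then have n: "n = spine q (comp_root q n) (row_index q n)"
    and m: "m = spine q (comp_root q n) (row_index q n + 1)"
    using row_root_spine[of n q] row_root_spine[of m q] nm q V_words row by auto
  show ?thesis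
  proof (cases "0 \<le> row_index q n")
    case True
    then have "m = 8 * n + q + 1" using n m spine_up[of "row_index q n" q "comp_root q n"] by simp
    moreover have "(8 * n + q + 1) div 8 = n" "(8 * n + q + 1) mod 8 = q + 1"
      using q by (auto; presburger)+
    ultimately show ?thesis by (auto simp: on_axis_def)
  next
    case False
    then have "n = 8 * m + q + 2" using n m spine_down[of "row_index q n + 1" q "comp_root q n"] by simp
    moreover have "(8 * m + q + 2) div 8 = m" "(8 * m + q + 2) mod 8 = q + 2"
      using q by (auto; presburger)+
    ultimately show ?thesis by (auto simp: on_axis_def)
  qed
qed

lemma sees_imp_parent:
  assumes nm: "n \<in> V" "m \<in> V" "n \<noteq> m" and q: "q \<in> {0, 3}"
    and sees: "sees V (coordinate (3 - q)) (coordinate q) n m"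
  shows "m div 8 = n \<and> on_axis q m \<or> n div 8 = m \<and> on_axis q n"
proof -
  obtain c d where "c < d" and band: "\<forall>t\<in>{c<..<d}. meets (coordinate q) n t \<and> meets (coordinate q) m t \<and>
     (\<forall>w\<in>V. meets (coordinate q) w t \<longrightarrow> \<not> strictly_between (coordinate (3 - q)) n m w)"
    using sees unfolding sees_def by blast
  then obtain t where "t \<in> {c<..<d}" using dense[of c d] by auto
  from bspec[OF band this] have t: "meets (coordinate q) n t" "meets (coordinate q) m t"
    and free: "\<And>w. w \<in> V \<Longrightarrow> meets (coordinate q) w t \<Longrightarrow> \<not> strictly_between (coordinate (3 - q)) n m w"
    by blast+
  have free': "\<And>w. w \<in> V \<Longrightarrow> meets (coordinate q) w t \<Longrightarrow> \<not> strictly_between (coordinate (3 - q)) m n w"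
    using free by (auto simp: strictly_between_def)
  note near = meets_near[OF t]
  note comp = near_same_comp[OF nm(1,2) near]
  have "row_index q m = row_index q n + 1 \<or> row_index q n = row_index q m + 1 \<or> row_index q n = row_index q m"
    using near comp(2) by linarith
  then consider "row_index q m = row_index q n + 1" | "row_index q n = row_index q m + 1"
    | "row_index q n = row_index q m" "n < m" | "row_index q m = row_index q n" "m < n"
    using nm(3) by linarith
  then show ?thesis
  proof cases
    case 1
    from sees_next_row[OF nm(1,2) q comp(1) 1 t free] show ?thesis .
  next
    case 2
    from sees_next_row[OF nm(2,1) q comp(1)[symmetric] 2 t(2,1) free'] show ?thesis by blast
  next
    case 3
    from sees_same_row[OF nm(1,2) 3(2) q comp(1) 3(1) t free] show ?thesis by blast
  next
    case 4
    from sees_same_row[OF nm(2,1) 4(2) q comp(1)[symmetric] 4(1) t(2,1) free'] show ?thesis by blast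
  qed
qed

text \<open>As \<open>coord\<close> counts half sides, the squares meeting the strip from
  \<open>b / 2\<close> to \<open>(b + 1) / 2\<close> are exactly those at \<open>b - 1\<close> and
  \<open>b\<close>. Visibility thus reduces to the order of positions in two adjacent rows.\<close>

lemma sees_half_band:
  assumes nm: "n \<in> V" "m \<in> V" and q: "q \<in> {0, 3}" and root: "comp_root q n = comp_root q m"
    and b: "coord M q n \<in> {b - 1, b}" "coord M q m \<in> {b - 1, b}"
    and free: "\<And>w. w \<in> V \<Longrightarrow> coord M q w \<in> {b - 1, b} \<Longrightarrow> comp_root q w = comp_root q n \<Longrightarrow>
      \<not> (pos q n < pos q w \<and> pos q w < pos q m \<or> pos q m < pos q w \<and> pos q w < pos q n)"
  shows "sees V (coordinate (3 - q)) (coordinate q) n m"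
proof -
  have meets: "meets (coordinate q) w t \<longleftrightarrow> coord M q w \<in> {b - 1, b}"
    if "t \<in> {real_of_int b / 2<..<(real_of_int b + 1) / 2}" for t :: real and w
  proof
    have t: "b < 2 * t" "2 * t < b + 1" using that by auto
    show "coord M q w \<in> {b - 1, b}" if "meets (coordinate q) w t"
    proof -
      have "real_of_int (coord M q w) < b + 1" "real_of_int b < coord M q w + 2"
        using t that unfolding meets_coordinate by linarith+
      then have "coord M q w \<le> b" "b - 1 \<le> coord M q w" by linarith+
      then show ?thesis by force
    qed
    show "meets (coordinate q) w t" if "coord M q w \<in> {b - 1, b}"
      using t that unfolding meets_coordinate by auto
  qed
  have unblocked: "\<not> strictly_between (coordinate (3 - q)) n m w" if w: "w \<in> V" "coord M q w \<in> {b - 1, b}" for w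
  proof -
    have "\<bar>coord M q w - coord M q n\<bar> \<le> 1" using w(2) b(1) by auto
    then have wn: "comp_root q w = comp_root q n" by (rule near_same_comp(1)[OF w(1) nm(1)])
    show ?thesis
      using strictly_between_coordinate[OF nm w(1) q wn[symmetric] trans[OF root[symmetric] wn[symmetric]]]
        free[OF w wn] by blast
  qed
  show ?thesis
    unfolding sees_def
  proof (rule exI[of _ "real_of_int b / 2"], rule exI[of _ "(real_of_int b + 1) / 2"],
      intro conjI ballI impI)
    show "real_of_int b / 2 < (real_of_int b + 1) / 2" by simp
    fix t :: real assume t: "t \<in> {real_of_int b / 2<..<(real_of_int b + 1) / 2}"
    show "meets (coordinate q) n t" "meets (coordinate q) m t"
      unfolding meets[OF t] by (rule b)+
    fix w assume "w \<in> V" "meets (coordinate q) w t"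
    then show "\<not> strictly_between (coordinate (3 - q)) n m w"
      unfolding meets[OF t] by (rule unblocked)
  qed
qed

lemma parent_sees:
  assumes m: "m \<in> V" "on_axis q m" and q: "q \<in> {0, 3}"
  shows "sees V (coordinate (3 - q)) (coordinate q) (m div 8) m"
proof -
  let ?p = "m div 8"
  have p: "?p \<in> V" using V_div m(1) by blast
  have pm: "?p < m" by (rule div8_less(1)[OF m(2)])
  have root: "comp_root q ?p = comp_root q m" using on_axis_simps(1)[OF m(2)] by simp
  have coord: "coord M q k - coord M q l = row_index q k - row_index q l" if "comp_root q k = comp_root q l" for k l
    using that by (simp add: coord_def)
  consider "m mod 8 = q + 3" | "m mod 8 = q + 1 \<or> m mod 8 = q + 2"
    using m(2) unfolding on_axis_def by linarith
  then show ?thesis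
  proof cases
    case 1
    have row: "row_index q ?p = row_index q m" using leg_same_row(2)[OF 1] by simp
    then have dir: "dir q ?p = dir q m" by (simp add: dir_def)
    \<comment> \<open>The strip is the half of the row shared with the preceding row. That row
      extends the opposite way, so a blocker would be in the row of \<open>m\<close>, where
      \<open>row_chain\<close> leaves no room between \<open>m\<close> and its parent.\<close>
    show ?thesis
    proof (rule sees_half_band[OF p m(1) q root])
      show "coord M q ?p \<in> {coord M q m - 1, coord M q m}" using coord[OF root] row by simp
      show "coord M q m \<in> {coord M q m - 1, coord M q m}" by simp
      fix w assume w: "w \<in> V" "coord M q w \<in> {coord M q m - 1, coord M q m}"
        "comp_root q w = comp_root q ?p"
      show "\<not> (pos q ?p < pos q w \<and> pos q w < pos q m \<or> pos q m < pos q w \<and> pos q w < pos q ?p)"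
      proof
        assume btw: "pos q ?p < pos q w \<and> pos q w < pos q m \<or> pos q m < pos q w \<and> pos q w < pos q ?p"
        then have wd: "dir q w = dir q m" "?p < w" "w < m"
          using dir dir_cases[of q m] dir_cases[of q w] by (auto simp: pos_def)
        have "row_index q w = row_index q m \<or> row_index q w = row_index q m - 1"
          using w(2) coord[OF trans[OF w(3) root]] by auto
        moreover have "even (row_index q w) \<longleftrightarrow> even (row_index q m)"
          using wd(1) by (simp add: dir_def split: if_splits)
        ultimately have "row_index q w = row_index q m" by auto
        then have "row_root q w = row_root q m"
          using w root m(1) q by (intro same_row_root) auto
        then show False using row_chain[of q w m] wd by simp
      qed
    qed
  next
    case 2
    have mw: "m \<in> words" "m \<noteq> 0" using m V_words by (auto simp: on_axis_def)
    have "?p mod 8 \<noteq> q + 3"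
      using words_allowed[OF mw] 2 q unfolding allowed_def by auto
    then have inner: "row_root q ?p = ?p" "row_root q m = m"
      using 2 by (auto simp: row_root_simps)
    have rows: "row_index q m = row_index q ?p + 1 \<or> row_index q m = row_index q ?p - 1"
      using 2 on_axis_simps(2,3)[OF m(2)] by auto
    then have dir: "dir q m = - dir q ?p" by (auto simp: dir_def)
    \<comment> \<open>The larger of two consecutive coordinates selects the half strip common to
      both rows. Both ends are innermost, so the other squares of these rows lie further
      out.\<close>
    let ?b = "max (coord M q ?p) (coord M q m)"
    show ?thesis
    proof (rule sees_half_band[OF p m(1) q root])
      show "coord M q ?p \<in> {?b - 1, ?b}" "coord M q m \<in> {?b - 1, ?b}"
        using coord[OF root] rows by auto
      fix w assume w: "w \<in> V" "coord M q w \<in> {?b - 1, ?b}" "comp_root q w = comp_root q ?p"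
      have "row_index q w = row_index q ?p \<or> row_index q w = row_index q m"
        using w(2) coord[OF w(3)] coord[OF root] rows by (auto simp: max_def split: if_splits)
      then have "row_root q w = ?p \<and> dir q w = dir q ?p \<or> row_root q w = m \<and> dir q w = dir q m"
        using same_row_root[OF w(1) p q w(3)] same_row_root[OF w(1) m(1) q] w(3) root inner
        by (auto simp: dir_def)
      then have "?p \<le> w \<and> dir q w = dir q ?p \<or> m \<le> w \<and> dir q w = dir q m"
        using row_root_le[of q w] by auto
      then show "\<not> (pos q ?p < pos q w \<and> pos q w < pos q m \<or> pos q m < pos q w \<and> pos q w < pos q ?p)"
        using dir dir_cases[of q ?p] by (auto simp: pos_def)
    qed
  qed
qed

text \<open>Squares overlapping in height belong to one horizontal component, where
  \<open>coord_order\<close> keeps abscissas two half sides apart.\<close>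

lemma separated_coordinates:
  assumes "n \<in> V" "m \<in> V" "n \<noteq> m"
  shows "separated (coordinate 3) (coordinate 0) n m"
proof -
  have "2 \<le> \<bar>coord M 3 n - coord M 3 m\<bar>" if near: "\<bar>coord M 0 n - coord M 0 m\<bar> \<le> 1"
  proof -
    have root: "comp_root 0 n = comp_root 0 m" using near_same_comp(1)[OF assms(1,2) near] .
    have "pos 0 n < pos 0 m \<or> pos 0 m < pos 0 n" using pos_inj[of 0 n m] assms(3) by linarith
    then show ?thesis
      using coord_order[OF assms(1,2) _ root] coord_order[OF assms(2,1) _ root[symmetric]] by auto
  qed
  then have "2 \<le> \<bar>coord M 3 n - coord M 3 m\<bar> \<or> 2 \<le> \<bar>coord M 0 n - coord M 0 m\<bar>" by linarith
  then have "2 \<le> \<bar>real_of_int (coord M 3 n) - coord M 3 m\<bar> \<or>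
      2 \<le> \<bar>real_of_int (coord M 0 n) - coord M 0 m\<bar>" by linarith
  then show ?thesis by (auto simp: separated_def coordinate_def abs_if field_simps split: if_splits)
qed

definition word_tree :: "nat pair_pre_digraph" where
  "word_tree = \<lparr>pverts = V, parcs = {(n, m). n \<in> V \<and> m \<in> V \<and> n \<noteq> m \<and> (n = m div 8 \<or> m = n div 8)}\<rparr>"

lemma urv_representation_word_tree:
  "urv_representation word_tree (usquare (coordinate 3) (coordinate 0))"
proof -
  have "((n, m) \<in> parcs word_tree) =
      (sees V (coordinate 3) (coordinate 0) n m \<or> sees V (coordinate 0) (coordinate 3) n m)"
    if nm: "n \<in> V" "m \<in> V" "n \<noteq> m" for n m
  proof
    assume "(n, m) \<in> parcs word_tree"
    then have "n = m div 8 \<and> m \<noteq> 0 \<or> m = n div 8 \<and> n \<noteq> 0" using nm by (auto simp: word_tree_def)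
    moreover have "sees V (coordinate 3) (coordinate 0) (k div 8) k \<or>
        sees V (coordinate 0) (coordinate 3) (k div 8) k" if "k \<in> V" "k \<noteq> 0" for k
      using words_axis(1)[of k] V_words that parent_sees[of k 0] parent_sees[of k 3] by auto
    ultimately show "sees V (coordinate 3) (coordinate 0) n m \<or> sees V (coordinate 0) (coordinate 3) n m"
      using nm sees_sym by metis
  next
    assume "sees V (coordinate 3) (coordinate 0) n m \<or> sees V (coordinate 0) (coordinate 3) n m"
    then show "(n, m) \<in> parcs word_tree"
      using sees_imp_parent[OF nm, of 0] sees_imp_parent[OF nm, of 3] nm by (auto simp: word_tree_def)
  qed
  then show ?thesis
    using separated_coordinates
    by (subst urv_representation_iff_sees[OF refl]) (simp add: word_tree_def)
qed

end

section \<open>Rooted trees given by a parent function\<close>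

locale parent_tree =
  fixes V :: "nat set" and par :: "nat \<Rightarrow> nat" and lev :: "nat \<Rightarrow> nat"
  assumes finite_V: "finite V"
    and zero_V: "0 \<in> V"
    and par_V: "n \<in> V \<Longrightarrow> par n \<in> V"
    and par_less: "n \<in> V \<Longrightarrow> n \<noteq> 0 \<Longrightarrow> par n < n"
    and par_0: "par 0 = 0"
    and lev_0: "lev 0 = 0"
    and lev_par: "n \<in> V \<Longrightarrow> n \<noteq> 0 \<Longrightarrow> lev n = Suc (lev (par n))"
begin

definition tree :: "nat pair_pre_digraph" where
  "tree = \<lparr>pverts = V, parcs = {(n, m). n \<in> V \<and> m \<in> V \<and> n \<noteq> m \<and> (n = par m \<or> m = par n)}\<rparr>"

lemma pverts_tree [simp]: "pverts tree = V"
  by (simp add: tree_def)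

lemma parcs_tree: "(n, m) \<in> parcs tree \<longleftrightarrow> n \<in> V \<and> m \<in> V \<and> n \<noteq> m \<and> (n = par m \<or> m = par n)"
  by (simp add: tree_def)

lemma smaller_neighbour: "(n, m) \<in> parcs tree \<Longrightarrow> n \<le> m \<Longrightarrow> n = par m"
  unfolding parcs_tree by (metis par_less par_0 leD)

lemma pair_graph_tree: "pair_graph tree"
proof
  have "parcs tree \<subseteq> V \<times> V" by (auto simp: parcs_tree)
  then show "finite (parcs tree)" using finite_V finite_subset by blast
  show "symmetric (with_proj tree)" by (auto simp: symmetric_def sym_def parcs_tree)
qed (use finite_V in \<open>auto simp: parcs_tree\<close>)

sublocale T: pair_graph tree
  by (rule pair_graph_tree)

lemma ex_awalk_lev:
  assumes "n \<in> V"
  shows "\<exists>p. T.awalk 0 p n \<and> length p = lev n"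
  using assms
proof (induction n rule: less_induct)
  case (less n)
  show ?case
  proof (cases "n = 0")
    case True
    then show ?thesis using zero_V lev_0 by (intro exI[of _ "[]"]) (simp add: T.awalk_Nil_iff)
  next
    case False
    have less_n: "par n < n" using par_less less.prems False by blast
    then obtain p where p: "T.awalk 0 p (par n)" "length p = lev (par n)"
      using less.IH par_V less.prems by blast
    have "T.awalk (par n) [(par n, n)] n"
      using less.prems par_V less_n by (auto simp: T.awalk_simps parcs_tree)
    then show ?thesis
      using T.awalk_appendI[OF p(1)] p(2) lev_par[OF less.prems False]
      by (intro exI[of _ "p @ [(par n, n)]"]) simp
  qed
qed

text \<open>An edge raises the level by at most 1, so no walk beats the one straight down from the
  root.\<close>

lemma lev_le_awalk: "T.awalk u p v \<Longrightarrow> lev v \<le> lev u + length p"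
proof (induction p arbitrary: u)
  case Nil
  then show ?case by (simp add: T.awalk_Nil_iff)
next
  case (Cons e p)
  then have e: "(u, snd e) \<in> parcs tree" and p: "T.awalk (snd e) p v"
    by (auto simp: T.awalk_Cons_iff)
  have "lev (snd e) \<le> Suc (lev u)"
    using e lev_par[of u] lev_par[of "snd e"] par_0 unfolding parcs_tree
    by (cases "u = 0"; cases "snd e = 0") auto
  with Cons.IH[OF p] show ?case by simp
qed

lemma verts_at_depth_tree: "verts_at_depth tree 0 k = {n \<in> V. lev n = k}"
proof -
  have "depth tree 0 n = ereal (real k) \<longleftrightarrow> lev n = k" if n: "n \<in> V" for n
  proof -
    obtain p where "T.awalk 0 p n" "length p = lev n" using ex_awalk_lev[OF n] by blast
    moreover have "lev n \<le> length q" if "T.awalk 0 q n" for q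
      using lev_le_awalk[OF that] lev_0 by simp
    ultimately show ?thesis
      unfolding depth_def T.unit_\<mu>_eq_iff by (metis order_antisym order_refl)
  qed
  then show ?thesis by (auto simp: verts_at_depth_def)
qed

lemma connected_tree: "Digraph_Component.connected (with_proj tree)"
proof -
  have "reachable (with_proj tree) u v" if "u \<in> V" "v \<in> V" for u v
  proof -
    have "reachable (with_proj tree) 0 u" "reachable (with_proj tree) 0 v"
      using ex_awalk_lev that by (auto simp: T.reachable_awalk)
    then show ?thesis using T.symmetric_reachable' T.reachable_trans by blast
  qed
  then show ?thesis
    using zero_V T.reachable_mk_symmetric_eq[OF T.sym_arcs]
    by (auto simp: connected_def strongly_connected_def)
qed

lemma awalk_consecutive:
  "T.awalk u p v \<Longrightarrow> Suc i < length p \<Longrightarrow> snd (p ! i) = fst (p ! Suc i)"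
proof (induction p arbitrary: u i)
  case (Cons e p)
  then have p: "T.awalk (snd e) p v" by (simp add: T.awalk_Cons_iff)
  show ?case
  proof (cases i)
    case 0
    then show ?thesis using p Cons.prems(2) by (cases p) (auto simp: T.awalk_Cons_iff)
  next
    case (Suc j)
    then show ?thesis using Cons.IH[OF p, of j] Cons.prems(2) by simp
  qed
qed simp

text \<open>The two neighbours on a cycle of its largest vertex are both its parent.\<close>

lemma no_cycle_tree: "\<not> (T.cycle p \<and> 3 \<le> length p)"
proof
  assume "T.cycle p \<and> 3 \<le> length p"
  then obtain u where p: "T.awalk u p u" "distinct (tl (pawalk_verts u p))" and n: "3 \<le> length p"
    by (auto simp: T.cycle_def)
  let ?n = "length p"
  have ne: "p \<noteq> []" using n by auto
  have "tl (pawalk_verts u p) = map snd p"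
    using T.awalk_verts_conv'[of u p u] p(1) ne by (auto simp: T.awalk_def)
  then have inj: "snd (p ! i) = snd (p ! j) \<longleftrightarrow> i = j" if "i < ?n" "j < ?n" for i j
    using p(2) that nth_eq_iff_index_eq[of "map snd p" i j] by simp
  have ends: "fst (p ! 0) = u" "snd (p ! (?n - 1)) = u"
  proof -
    show "fst (p ! 0) = u" using p(1) ne by (cases p) (auto simp: T.awalk_Cons_iff)
    have "last (pawalk_verts u p) = u" using p(1) by auto
    then show "snd (p ! (?n - 1)) = u"
      using ne T.awalk_verts_conv[of u p] by (simp add: last_conv_nth)
  qed
  have next_arc: "fst (p ! (if Suc i = ?n then 0 else Suc i)) = snd (p ! i)" if "i < ?n" for i
  proof (cases "Suc i = ?n")
    case True
    then have "i = ?n - 1" by simp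
    then show ?thesis using True ends by simp
  next
    case False
    then have "Suc i < ?n" using that by simp
    then show ?thesis using awalk_consecutive[OF p(1), of i] by simp
  qed
  have arc: "(fst (p ! i), snd (p ! i)) \<in> parcs tree" if "i < ?n" for i
    using that p(1) nth_mem[OF that] by (auto simp: T.awalk_def)
  have "finite ((\<lambda>i. snd (p ! i)) ` {..<?n})" "(\<lambda>i. snd (p ! i)) ` {..<?n} \<noteq> {}"
    using ne by (auto simp: lessThan_empty_iff)
  from Max_in[OF this] obtain i where i: "i < ?n"
    and "snd (p ! i) = Max ((\<lambda>i. snd (p ! i)) ` {..<?n})" by auto
  then have max: "snd (p ! j) \<le> snd (p ! i)" if "j < ?n" for j using that by simp
  let ?next = "if Suc i = ?n then 0 else Suc i"
  let ?prev = "if i = 0 then ?n - 1 else i - 1"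
  have next_less: "?next < ?n" and prev_less: "?prev < ?n" using i by auto
  have "fst (p ! i) = snd (p ! ?prev)"
    using next_arc[OF prev_less] n i by (cases "i = 0") auto
  then have "(snd (p ! ?prev), snd (p ! i)) \<in> parcs tree" using arc[OF i] by metis
  then have "snd (p ! ?prev) = par (snd (p ! i))"
    by (rule smaller_neighbour) (rule max[OF prev_less])
  moreover have "(snd (p ! i), snd (p ! ?next)) \<in> parcs tree"
    using arc[OF next_less] next_arc[OF i] by metis
  then have "snd (p ! ?next) = par (snd (p ! i))"
    using T.arcs_symmetric smaller_neighbour max[OF next_less] by blast
  ultimately have "?prev = ?next" using inj[OF prev_less next_less] by metis
  then show False using n i by (auto split: if_splits)
qed

lemma rooted_tree: "rooted_tree tree 0"
  using pair_graph_tree connected_tree no_cycle_tree zero_V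
  by (auto simp: rooted_tree_def undirected_tree_def)

end

section \<open>Counting words by their last digit\<close>

fun word_length :: "nat \<Rightarrow> nat" where
  "word_length n = (if n = 0 then 0 else Suc (word_length (n div 8)))"

declare word_length.simps [simp del]

lemma word_length_0: "word_length 0 = 0"
  by (simp add: word_length.simps)

lemma word_length_pos: "n \<noteq> 0 \<Longrightarrow> word_length n = Suc (word_length (n div 8))"
  by (subst word_length.simps) simp

lemma word_length_eq_0_iff: "word_length n = 0 \<longleftrightarrow> n = 0"
  by (cases "n = 0") (simp_all add: word_length_0 word_length_pos)

lemma less_8_power_word_length: "n < 8 ^ word_length n"
proof (induction n rule: word_length.induct)
  case (1 n)
  show ?case
  proof (cases "n = 0")
    case False
    then have "n div 8 < 8 ^ word_length (n div 8)" using 1 by blast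
    then have "n < 8 * 8 ^ word_length (n div 8)" by linarith
    then show ?thesis using False by (simp add: word_length_pos)
  qed (simp add: word_length_0)
qed

definition short_words :: "nat \<Rightarrow> nat set" where
  "short_words k = {n \<in> words. word_length n \<le> k}"

lemma short_words_bound: "n \<in> short_words k \<Longrightarrow> n < 8 ^ k"
proof -
  assume "n \<in> short_words k"
  then have "(8::nat) ^ word_length n \<le> 8 ^ k"
    by (intro power_increasing) (auto simp: short_words_def)
  with less_8_power_word_length[of n] show ?thesis by linarith
qed

lemma short_words_div: "n \<in> short_words k \<Longrightarrow> n div 8 \<in> short_words k"
  using words_div[of n] word_length_pos[of n] by (cases "n = 0") (auto simp: short_words_def)

lemma finite_short_words: "finite (short_words k)"
proof (rule finite_subset)
  show "short_words k \<subseteq> {..<8 ^ k}" by (simp add: subset_iff short_words_bound)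
qed simp

text \<open>The factor satisfies \<open>M_large\<close> because a word of at most \<open>k\<close>
  octal digits is below \<open>8 ^ k\<close>.\<close>

lemma layout_short_words: "layout (short_words k) (2 * 8 ^ k + 3)"
proof
  fix n assume n: "n \<in> short_words k"
  then show "n div 8 \<in> short_words k" by (rule short_words_div)
  have "int n < int (8 ^ k)" using short_words_bound[OF n] by (simp only: of_nat_less_iff)
  then show "2 * int n + 3 \<le> 2 * 8 ^ k + 3" by simp
qed (auto simp: short_words_def)

lemma parent_tree_short_words: "parent_tree (short_words k) (\<lambda>n. n div 8) word_length"
proof
  show "0 \<in> short_words k" by (simp add: short_words_def words.zero word_length_0)
qed (auto simp: finite_short_words short_words_div word_length_0 word_length_pos)

definition words_ending :: "nat \<Rightarrow> nat \<Rightarrow> nat set" where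
  "words_ending k d = {n \<in> words. word_length n = k \<and> n mod 8 = d}"

lemma finite_words_ending: "finite (words_ending k d)"
  by (rule finite_subset[OF _ finite_short_words[of k]]) (auto simp: words_ending_def short_words_def)

lemma words_ending_disjoint: "d \<noteq> e \<Longrightarrow> words_ending k d \<inter> words_ending k e = {}"
  by (auto simp: words_ending_def)

lemma words_ending_Suc:
  assumes "e \<in> {1..6}"
  shows "words_ending (Suc k) e = (\<lambda>n. 8 * n + e) ` (\<Union>d\<in>{d\<in>{..6}. allowed d e}. words_ending k d)"
proof (intro equalityI subsetI)
  fix n assume "n \<in> words_ending (Suc k) e"
  then have n: "n \<in> words" "word_length n = Suc k" "n mod 8 = e" by (auto simp: words_ending_def)
  then have "n \<noteq> 0" using word_length_0 by (intro notI) simp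
  have "allowed (n div 8 mod 8) e" using words_allowed[OF n(1) \<open>n \<noteq> 0\<close>] n(3) by simp
  moreover have "n div 8 mod 8 \<le> 6"
    using words_allowed[OF words_div[OF n(1)]] by (cases "n div 8 = 0") (auto simp: allowed_def)
  moreover have "n div 8 \<in> words_ending k (n div 8 mod 8)"
    using n words_div[OF n(1)] word_length_pos[OF \<open>n \<noteq> 0\<close>] by (simp add: words_ending_def)
  moreover have "n = 8 * (n div 8) + e" using n(3) by auto
  ultimately show "n \<in> (\<lambda>n. 8 * n + e) ` (\<Union>d\<in>{d\<in>{..6}. allowed d e}. words_ending k d)"
    by blast
next
  fix m assume "m \<in> (\<lambda>n. 8 * n + e) ` (\<Union>d\<in>{d\<in>{..6}. allowed d e}. words_ending k d)"
  then obtain n where n: "n \<in> words" "word_length n = k" "allowed (n mod 8) e" and m: "m = 8 * n + e"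
    by (auto simp: words_ending_def)
  have "m mod 8 = e" "m div 8 = n" "m \<noteq> 0" using assms m by auto
  then show "m \<in> words_ending (Suc k) e"
    using n words.child[of m] word_length_pos[of m] by (simp add: words_ending_def)
qed

lemma card_words_ending_Suc:
  assumes "e \<in> {1..6}"
  shows "card (words_ending (Suc k) e) = (\<Sum>d\<le>6. if allowed d e then card (words_ending k d) else 0)"
proof -
  have "card (words_ending (Suc k) e) = card (\<Union>d\<in>{d\<in>{..6}. allowed d e}. words_ending k d)"
    unfolding words_ending_Suc[OF assms] by (intro card_image) (auto simp: inj_on_def)
  also have "\<dots> = (\<Sum>d\<in>{d\<in>{..6}. allowed d e}. card (words_ending k d))"
    by (intro card_UN_disjoint) (auto simp: finite_words_ending words_ending_disjoint)
  also have "\<dots> = (\<Sum>d\<le>6. if allowed d e then card (words_ending k d) else 0)"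
    by (rule sum.inter_filter) simp
  finally show ?thesis .
qed

lemma sum_atMost_6: "(\<Sum>d\<le>(6::nat). f d) = f 0 + f 1 + f 2 + f 3 + f 4 + f 5 + f (6::nat)"
  for f :: "nat \<Rightarrow> nat"
  by (simp add: eval_nat_numeral)

lemma card_words_ending:
  "card (words_ending (Suc k) 1) = card (words_ending k 0) + card (words_ending k 1) +
     card (words_ending k 4) + card (words_ending k 5) + card (words_ending k 6)"
  "card (words_ending (Suc k) 2) = card (words_ending k 0) + card (words_ending k 2) +
     card (words_ending k 4) + card (words_ending k 5) + card (words_ending k 6)"
  "card (words_ending (Suc k) 3) = card (words_ending k 0) + card (words_ending k 1) + card (words_ending k 2) +
     card (words_ending k 3) + card (words_ending k 4) + card (words_ending k 5) + card (words_ending k 6)"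
  "card (words_ending (Suc k) 4) = card (words_ending k 0) + card (words_ending k 1) +
     card (words_ending k 2) + card (words_ending k 3) + card (words_ending k 4)"
  "card (words_ending (Suc k) 5) = card (words_ending k 0) + card (words_ending k 1) +
     card (words_ending k 2) + card (words_ending k 3) + card (words_ending k 5)"
  "card (words_ending (Suc k) 6) = card (words_ending k 0) + card (words_ending k 1) + card (words_ending k 2) +
     card (words_ending k 3) + card (words_ending k 4) + card (words_ending k 5) + card (words_ending k 6)"
  by (subst card_words_ending_Suc; simp add: sum_atMost_6 allowed_def)+

lemma words_ending_0: "words_ending 0 d = (if d = 0 then {0} else {})"
  by (auto simp: words_ending_def words.zero word_length_eq_0_iff)

lemma words_ending_Suc_0: "words_ending (Suc k) 0 = {}"
proof -
  have "n mod 8 \<noteq> 0" if "n \<in> words" "word_length n = Suc k" for n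
    using words_allowed[OF that(1)] that(2) word_length_0 by (cases "n = 0") (auto simp: allowed_def)
  then show ?thesis by (auto simp: words_ending_def)
qed

lemma card_words_of_length:
  "card {n \<in> words. word_length n = Suc k} = (\<Sum>d\<le>6. card (words_ending (Suc k) d))"
proof -
  have "n mod 8 \<le> 6" if "n \<in> words" "word_length n = Suc k" for n
    using words_allowed[OF that(1)] that(2) word_length_0 by (cases "n = 0") (auto simp: allowed_def)
  then have "{n \<in> words. word_length n = Suc k} = (\<Union>d\<le>6. words_ending (Suc k) d)"
    by (auto simp: words_ending_def)
  also have "card \<dots> = (\<Sum>d\<le>6. card (words_ending (Suc k) d))"
    by (intro card_UN_disjoint) (auto simp: finite_words_ending words_ending_disjoint)
  finally show ?thesis .
qed

text \<open>By symmetry two numbers suffice: \<open>s\<close> words for each of the four spine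
  digits and \<open>l\<close> for each of the two leg digits. So \<open>a\<close> counts the words
  ending in a spine digit and \<open>c\<close> all words.\<close>

lemma recurrence_card_words_ending:
  fixes a c :: "nat \<Rightarrow> nat"
  assumes init: "a 1 = 4" "c 1 = 6"
    and a: "\<And>k. k \<ge> 2 \<Longrightarrow> a k = a (k - 1) + 2 * c (k - 1)"
    and c: "\<And>k. k \<ge> 2 \<Longrightarrow> c k = a (k - 1) + 4 * c (k - 1)"
  shows "\<exists>s l. (\<forall>d\<in>{1, 2, 4, 5}. card (words_ending (Suc k) d) = s) \<and>
    (\<forall>d\<in>{3, 6}. card (words_ending (Suc k) d) = l) \<and> a (Suc k) = 4 * s \<and> c (Suc k) = 4 * s + 2 * l"
proof (induction k)
  case 0
  have "a (Suc 0) = 4" "c (Suc 0) = 6" using init by simp_all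
  then show ?case by (simp add: card_words_ending words_ending_0 del: One_nat_def)
next
  case (Suc k)
  then obtain s l where IH: "\<forall>d\<in>{1, 2, 4, 5}. card (words_ending (Suc k) d) = s"
    "\<forall>d\<in>{3, 6}. card (words_ending (Suc k) d) = l" "a (Suc k) = 4 * s" "c (Suc k) = 4 * s + 2 * l"
    by blast
  have "a (Suc (Suc k)) = a (Suc k) + 2 * c (Suc k)" "c (Suc (Suc k)) = a (Suc k) + 4 * c (Suc k)"
    using a[of "Suc (Suc k)"] c[of "Suc (Suc k)"] by simp_all
  then show ?case
    using IH
    \<comment> \<open>A spine digit may follow itself and the three digits of the other axis, which
      gives \<open>3 * s + l\<close>; a leg digit may follow all six digits.\<close>
    by (intro exI[of _ "3 * s + l"] exI[of _ "4 * s + 2 * l"])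
      (simp add: card_words_ending[of "Suc k"] words_ending_Suc_0 del: One_nat_def)
qed

theorem theorem6p2:
  fixes a c :: "nat \<Rightarrow> nat"
  assumes "a 1 = 4" and "c 1 = 6"
    and "\<And>k. k \<ge> 2 \<Longrightarrow> a k = a (k - 1) + 2 * c (k - 1)"
    and "\<And>k. k \<ge> 2 \<Longrightarrow> c k = a (k - 1) + 4 * c (k - 1)"
  shows "(\<forall>(T :: 'a pair_pre_digraph) r. rooted_tree T r \<and> URVG T \<longrightarrow>
            (\<forall>k\<ge>1. card (verts_at_depth T r k) \<le> c k)) \<and>
         (\<forall>k\<ge>1. \<exists>(T :: nat pair_pre_digraph) r. rooted_tree T r \<and> URVG T \<and>
            card (verts_at_depth T r k) = c k)"
proof (intro conjI allI impI)
  fix T :: "'a pair_pre_digraph" and r and k :: nat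
  assume T: "rooted_tree T r \<and> URVG T" and "1 \<le> k"
  then obtain k' where k: "k = Suc k'" by (cases k) auto
  show "card (verts_at_depth T r k) \<le> c k"
    using card_verts_at_depth_le[of T r k'] T recurrence_half_level[OF assms, of k'] k
    by (simp del: half_level.simps)
next
  fix k :: nat
  assume "1 \<le> k"
  then obtain k' where k: "k = Suc k'" by (cases k) auto
  interpret layout "short_words k" "2 * 8 ^ k + 3" by (rule layout_short_words)
  interpret parent_tree "short_words k" "\<lambda>n. n div 8" word_length
    by (rule parent_tree_short_words)
  have "tree = word_tree" by (simp add: tree_def word_tree_def)
  then have "URVG tree"
    using pair_graph_tree urv_representation_word_tree by (auto simp: URVG_def)
  moreover have "card (verts_at_depth tree 0 k) = c k"
  proof -
    have "verts_at_depth tree 0 k = {n \<in> words. word_length n = k}"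
      unfolding verts_at_depth_tree by (auto simp: short_words_def)
    then have "card (verts_at_depth tree 0 k) = (\<Sum>d\<le>6. card (words_ending k d))"
      using card_words_of_length[of k'] k by simp
    also have "\<dots> = c k"
      using recurrence_card_words_ending[OF assms, of k'] k words_ending_Suc_0[of k']
      by (auto simp: sum_atMost_6)
    finally show ?thesis .
  qed
  ultimately show "\<exists>(T :: nat pair_pre_digraph) r. rooted_tree T r \<and> URVG T \<and>
      card (verts_at_depth T r k) = c k"
    using rooted_tree by blast
qed

end
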